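(* Let $a,b\in\mathbb{R}$ and suppose that the rotation number $r(S_{ab})$ is irrational. (1) For any half-open sector $J=\mathbb{R}^+[\mathbf{v},\mathbf{v}')$, the first return map $T_J:J\to J$ of $T_{ab}$ to $J$ is piecewise linear with at most five pieces. (2) Let $m_+,m_-,n_+,n_-$ be nonnegative integers and set $\mathcal{O}=\mathcal{O}_1\cup\mathcal{O}_2\cup\mathcal{O}_3\cup\mathcal{O}_4$, where $\mathcal{O}_1=\{T_{ab}^{(1+i)}(0,1):0\le i<m_+\}$, $\mathcal{O}_2=\{T_{ab}^{(-i)}(0,1):0\le i<m_-\}$, $\mathcal{O}_3=\{T_{ab}^{(1+i)}(0,-1):0\le i<n_+\}$, $\mathcal{O}_4=\{T_{ab}^{(-i)}(0,-1):0\le i<n_-\}$. Let $J=\mathbb{R}^+[\mathbf{v},\mathbf{v}')$ be a half-open sector with $\mathbf{v},\mathbf{v}'\in\mathcal{O}$ such that no point of $\mathcal{O}$ lies in the interior of $J$. Then the first return map $T_J:J\to J$ is piecewise linear with at most three pieces.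
   Context: For real parameters $a,b$, the map $T_{ab}:\mathbb{R}^2\to\mathbb{R}^2$ is $T_{ab}(x,y)=(ax-y,x)$ if $x\ge 0$ and $T_{ab}(x,y)=(bx-y,x)$ if $x<0$; it is a homeomorphism, positively homogeneous of degree one, mapping rays from the origin onto rays from the origin. $T_{ab}^{(j)}$ denotes the $j$-th iterate ($j\in\mathbb{Z}$). $S_{ab}:S^1\to S^1$, $S_{ab}(\mathbf{u})=T_{ab}(\mathbf{u})/|T_{ab}(\mathbf{u})|$, and $r(S_{ab})$ is its Poincaré rotation number (counterclockwise, in full turns). For nonzero $\mathbf{v},\mathbf{v}'$ not on a common ray, the half-open sector $\mathbb{R}^+[\mathbf{v},\mathbf{v}')$ is the set of points $t\mathbf{w}$, $t>0$, with $\mathbf{w}$ ranging over directions obtained by going counterclockwise from the direction of $\mathbf{v}$ (included) to the direction of $\mathbf{v}'$ (excluded). The first return map $T_J$ to a sector $J$ sends $\mathbf{w}\in J$ to $T_{ab}^{(k)}(\mathbf{w})$ where $k\ge1$ is minimal with $T_{ab}^{(k)}(\mathbf{w})\in J$ (well defined when $r(S_{ab})$ is irrational). A map on $J$ is piecewise linear with at most $k$ pieces if $J$ can be divided by rays from the origin into at most $k$ subsectors on each of which it agrees with a linear map of $\mathbb{R}^2$. *)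

theory Defs
  imports "HOL-Analysis.Analysis"
begin

definition Tab :: "real \<Rightarrow> real \<Rightarrow> real \<times> real \<Rightarrow> real \<times> real" where
  "Tab a b p = (if fst p \<ge> 0 then (a * fst p - snd p, fst p) else (b * fst p - snd p, fst p))"

definition Tab_iter :: "real \<Rightarrow> real \<Rightarrow> int \<Rightarrow> real \<times> real \<Rightarrow> real \<times> real" where
  "Tab_iter a b j = (if 0 \<le> j then (Tab a b) ^^ (nat j) else (inv (Tab a b)) ^^ (nat (- j)))"

definition Sab :: "real \<Rightarrow> real \<Rightarrow> real \<times> real \<Rightarrow> real \<times> real" where
  "Sab a b u = (1 / norm (Tab a b u)) *\<^sub>R Tab a b u"

definition circ :: "real \<Rightarrow> real \<times> real" where
  "circ \<theta> = (cos (2 * pi * \<theta>), sin (2 * pi * \<theta>))"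

text \<open>Poincare rotation number (in full turns, counterclockwise): \<rho> is a rotation number of
  S_ab if it is the limit of F^n(0)/n for some continuous lift F of S_ab. It is
  determined modulo 1 (different lifts differ by integers).\<close>
definition has_rotation_number :: "real \<Rightarrow> real \<Rightarrow> real \<Rightarrow> bool" where
  "has_rotation_number a b \<rho> \<longleftrightarrow>
     (\<exists>F. continuous_on UNIV F \<and> (\<forall>\<theta>. Sab a b (circ \<theta>) = circ (F \<theta>)) \<and>
          (\<lambda>n. (F ^^ n) 0 / real n) \<longlonglongrightarrow> \<rho>)"

definition ccw_angle :: "real \<times> real \<Rightarrow> real \<times> real \<Rightarrow> real" where
  "ccw_angle v w = frac ((Arg (Complex (fst w) (snd w)) - Arg (Complex (fst v) (snd v))) / (2 * pi))"

definition sector :: "real \<times> real \<Rightarrow> real \<times> real \<Rightarrow> (real \<times> real) set" where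
  "sector v v' = {w. w \<noteq> 0 \<and> ccw_angle v w < ccw_angle v v'}"

definition same_ray :: "real \<times> real \<Rightarrow> real \<times> real \<Rightarrow> bool" where
  "same_ray v v' \<longleftrightarrow> (\<exists>t>0. v' = t *\<^sub>R v)"

definition first_return :: "real \<Rightarrow> real \<Rightarrow> (real \<times> real) set \<Rightarrow> real \<times> real \<Rightarrow> real \<times> real" where
  "first_return a b J w = ((Tab a b) ^^ (LEAST k. k \<ge> 1 \<and> ((Tab a b) ^^ k) w \<in> J)) w"

text \<open>f is piecewise linear with at most k pieces on the sector R^+[v,v'): the sector is divided
  by rays from the origin into at most k non-degenerate subsectors (angular intervals, with each
  dividing ray assigned to one adjacent subsector), on each of which f agrees with a linear map.\<close>
definition pw_linear_sector ::
  "real \<times> real \<Rightarrow> real \<times> real \<Rightarrow> (real \<times> real \<Rightarrow> real \<times> real) \<Rightarrow> nat \<Rightarrow> bool" where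
  "pw_linear_sector v v' f k \<longleftrightarrow>
     (\<exists>\<P>. finite \<P> \<and> card \<P> \<le> k \<and> \<Union>\<P> = sector v v' \<and> disjoint \<P> \<and>
        (\<forall>P\<in>\<P>. (\<exists>I. is_interval I \<and> (\<exists>s t. s < t \<and> s \<in> I \<and> t \<in> I) \<and>
                      P = {w \<in> sector v v'. ccw_angle v w \<in> I}) \<and>
                 (\<exists>L. linear L \<and> (\<forall>w\<in>P. f w = L w))))"

end

theory Submission
  imports Defs
begin

text \<open>
A lift \<open>F\<close> of \<open>S\<^sub>a\<^sub>b\<close> is an increasing homeomorphism of the line commuting with integer translations,
hence semiconjugate, by a monotone map \<open>h\<close>, to the translation by the rotation number \<open>\<rho>\<close>. Denjoy's
argument shows that \<open>h\<close> is injective: on a wandering sector free of break directions all iterates of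
\<open>T\<close> are linear with determinant 1, so with \<open>u\<close>, \<open>u'\<close> its boundary vectors the product of
\<open>|T\<^sup>q u|\<close>, \<open>|T\<^sup>q u'|\<close> and the sine of the angle between them does not depend on the integer \<open>q\<close>.
At closest return times \<open>q\<close> bounded distortion makes
\<open>|T\<^sup>q u| |T\<^sup>-\<^sup>q u|\<close> bounded, although the angles tend to 0. So directions move like points of a circle
under an irrational rotation, and every sector \<open>J\<close> is recurrent.

Sweep a ray counterclockwise through \<open>J\<close>. The return map can change its linear formula only where
some iterate, before or at the return, crosses one of the four marks \<open>v\<close>, \<open>v'\<close>, \<open>T(0,1)\<close>, \<open>T(0,-1)\<close>,
that is, only at the first point in \<open>J\<close> of the backward orbit of a mark. Four such cuts give at most
five pieces. In the second part all marks lie on the orbits of \<open>(0,1)\<close> and \<open>(0,-1)\<close>, and for each of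
these two orbits there is only one cut not on the boundary ray through \<open>v\<close>.
\<close>

section \<open>Angles and lifts to the line\<close>

definition ang :: "real \<times> real \<Rightarrow> real" where
  "ang p = Arg (Complex (fst p) (snd p)) / (2 * pi)"

lemma ccw_angle_ang: "ccw_angle v w = frac (ang w - ang v)"
  by (simp add: ccw_angle_def ang_def diff_divide_distrib)

lemma circ_ang: "p = norm p *\<^sub>R circ (ang p)"
proof -
  obtain x y where p: "p = (x, y)" by (cases p)
  have n: "norm p = cmod (Complex x y)"
    by (simp add: p norm_Pair cmod_def)
  have "Complex x y = rcis (cmod (Complex x y)) (Arg (Complex x y))"
    by (simp add: rcis_cmod_Arg)
  then have "x = cmod (Complex x y) * cos (Arg (Complex x y))"
    and "y = cmod (Complex x y) * sin (Arg (Complex x y))"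
    by (metis Re_rcis complex.sel(1), metis Im_rcis complex.sel(2))
  then show ?thesis
    using n by (simp add: circ_def ang_def p)
qed

lemma circ_eq_iff: "circ s = circ t \<longleftrightarrow> s - t \<in> \<int>"
proof -
  have "circ s = circ t \<longleftrightarrow> (\<exists>n::int. 2 * pi * s = 2 * pi * t + 2 * pi * n)"
    unfolding circ_def using sin_cos_eq_iff[of "2 * pi * s" "2 * pi * t"] by auto
  also have "\<dots> \<longleftrightarrow> (\<exists>n::int. s = t + n)"
  proof -
    have "2 * pi * s = 2 * pi * t + 2 * pi * n \<longleftrightarrow> s = t + n" for n :: real
      using mult_cancel_left[of "2 * pi" s "t + n"] by (simp add: distrib_left)
    then show ?thesis by auto
  qed
  also have "\<dots> \<longleftrightarrow> s - t \<in> \<int>"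
    by (auto simp: Ints_def algebra_simps)
  finally show ?thesis .
qed

lemma norm_circ [simp]: "norm (circ s) = 1"
  by (simp add: circ_def norm_Pair)

lemma circ_nonzero [simp]: "circ s \<noteq> 0"
  using norm_circ[of s] by force

lemma circ_add_int: "n \<in> \<int> \<Longrightarrow> circ (s + n) = circ s"
  by (simp add: circ_eq_iff)

lemma ang_eqI:
  assumes "r > 0" "p = r *\<^sub>R circ s"
  shows "ang p - s \<in> \<int>"
proof -
  have "norm p = r" using assms by simp
  then have "r *\<^sub>R circ (ang p) = r *\<^sub>R circ s"
    using circ_ang[of p] assms by simp
  then show ?thesis using assms by (simp add: circ_eq_iff)
qed

lemma same_ray_iff_ang:
  assumes "v \<noteq> 0" "w \<noteq> 0"
  shows "same_ray v w \<longleftrightarrow> ang w - ang v \<in> \<int>"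
proof
  assume "same_ray v w"
  then obtain t where t: "t > 0" "w = t *\<^sub>R v" by (auto simp: same_ray_def)
  then have "w = (t * norm v) *\<^sub>R circ (ang v)" by (metis circ_ang scaleR_scaleR)
  then show "ang w - ang v \<in> \<int>" using t assms by (intro ang_eqI) auto
next
  assume "ang w - ang v \<in> \<int>"
  then have "circ (ang w) = circ (ang v)" by (simp add: circ_eq_iff)
  then have "w = norm w *\<^sub>R circ (ang v)" using circ_ang by metis
  moreover have "v = norm v *\<^sub>R circ (ang v)" by (rule circ_ang)
  ultimately have "w = (norm w / norm v) *\<^sub>R v"
    using assms(1) by (metis nonzero_divide_eq_eq norm_eq_zero scaleR_scaleR)
  then show "same_ray v w" unfolding same_ray_def
    using assms by (intro exI[of _ "norm w / norm v"]) simp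
qed

section \<open>Homogeneity, the inverse map and injectivity on directions\<close>

lemma Tab_scaleR: "c > 0 \<Longrightarrow> Tab a b (c *\<^sub>R p) = c *\<^sub>R Tab a b p"
  by (cases p) (auto simp: Tab_def algebra_simps zero_le_mult_iff)

lemma Tab_zero [simp]: "Tab a b 0 = 0"
  by (simp add: Tab_def zero_prod_def)

definition Tinv :: "real \<Rightarrow> real \<Rightarrow> real \<times> real \<Rightarrow> real \<times> real" where
  "Tinv a b p = (snd p, (if snd p \<ge> 0 then a else b) * snd p - fst p)"

lemma Tab_Tinv [simp]: "Tab a b (Tinv a b p) = p"
  by (cases p) (auto simp: Tab_def Tinv_def)

lemma Tinv_Tab [simp]: "Tinv a b (Tab a b p) = p"
  by (cases p) (auto simp: Tab_def Tinv_def)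

lemma inv_Tab: "inv (Tab a b) = Tinv a b"
  by (rule inv_equality) auto

lemma Tab_inject: "Tab a b p = Tab a b q \<longleftrightarrow> p = q"
  by (metis Tinv_Tab)

lemma Tab_eq_zero_iff [simp]: "Tab a b p = 0 \<longleftrightarrow> p = 0"
  by (metis Tab_zero Tinv_Tab)

lemma Tinv_eq_zero_iff [simp]: "Tinv a b p = 0 \<longleftrightarrow> p = 0"
  by (metis Tab_Tinv Tab_eq_zero_iff)

lemma Tab_funpow_eq_zero_iff [simp]: "(Tab a b ^^ n) p = 0 \<longleftrightarrow> p = 0"
  by (induction n) auto

lemma Tinv_funpow_eq_zero_iff [simp]: "(Tinv a b ^^ n) p = 0 \<longleftrightarrow> p = 0"
  by (induction n) auto

text \<open>Homogeneity moves the normalising factors inside \<open>Tab\<close>, whose injectivity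
  then identifies two multiples of unit vectors; comparing norms shows that the factors
  agree.\<close>

lemma Sab_circ_inj:
  assumes "Sab a b (circ s) = Sab a b (circ t)"
  shows "s - t \<in> \<int>"
proof -
  define m where "m = norm (Tab a b (circ s))"
  define n where "n = norm (Tab a b (circ t))"
  have pos: "m > 0" "n > 0" by (auto simp: m_def n_def)
  have "(1 / m) *\<^sub>R Tab a b (circ s) = (1 / n) *\<^sub>R Tab a b (circ t)"
    using assms by (simp add: Sab_def m_def n_def)
  then have "Tab a b ((1 / m) *\<^sub>R circ s) = Tab a b ((1 / n) *\<^sub>R circ t)"
    using pos by (simp add: Tab_scaleR)
  then have eq: "(1 / m) *\<^sub>R circ s = (1 / n) *\<^sub>R circ t"
    by (simp add: Tab_inject)
  then have "norm ((1 / m) *\<^sub>R circ s) = norm ((1 / n) *\<^sub>R circ t)" by simp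
  then have "m = n" using pos by simp
  then show ?thesis using eq pos by (simp add: circ_eq_iff)
qed

section \<open>The lift is an increasing homeomorphism of degree one\<close>

locale lifted_map =
  fixes a b :: real and F :: "real \<Rightarrow> real" and \<rho> :: real
  assumes cont: "continuous_on UNIV F"
    and lift: "\<And>\<theta>. Sab a b (circ \<theta>) = circ (F \<theta>)"
    and lim: "(\<lambda>n. (F ^^ n) 0 / real n) \<longlonglongrightarrow> \<rho>"
    and irr: "\<rho> \<notin> \<rat>"
begin

abbreviation "T \<equiv> Tab a b"
abbreviation "Ti \<equiv> Tinv a b"

lemma T_circ: "T (circ \<theta>) = norm (T (circ \<theta>)) *\<^sub>R circ (F \<theta>)"
  by (simp flip: lift add: Sab_def)

lemma F_Ints_diff: "F s - F t \<in> \<int> \<longleftrightarrow> s - t \<in> \<int>"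
proof
  assume "F s - F t \<in> \<int>"
  then have "circ (F s) = circ (F t)" by (simp add: circ_eq_iff)
  then show "s - t \<in> \<int>" by (metis lift Sab_circ_inj)
next
  assume "s - t \<in> \<int>"
  then have "circ s = circ t" by (simp add: circ_eq_iff)
  then show "F s - F t \<in> \<int>" by (metis lift circ_eq_iff)
qed

lemma F_no_short_return:
  assumes "p < q" "q - p < 1"
  shows "F p \<noteq> F q"
proof
  assume "F p = F q"
  then have "q - p \<in> \<int>" using F_Ints_diff[of q p] by simp
  then show False using assms by (auto elim!: Ints_cases)
qed

text \<open>The difference \<open>F (x + 1) - F x\<close> is continuous and integer valued on a
  connected set, hence constant.\<close>

lemma F_degree: "\<exists>d::int. \<forall>x. F (x + 1) = F x + of_int d"
proof -
  have c: "continuous_on UNIV (\<lambda>x. F (x + 1) - F x)"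
    by (intro continuous_intros continuous_on_compose2[OF cont] continuous_on_subset[OF cont]) auto
  have int: "F (x + 1) - F x \<in> \<int>" for x by (simp add: F_Ints_diff)
  have "(\<lambda>x. F (x + 1) - F x) constant_on UNIV"
  proof (rule continuous_discrete_range_constant[OF connected_UNIV c])
    fix x :: real
    show "\<exists>e>0. \<forall>y. y \<in> UNIV \<and> F (y + 1) - F y \<noteq> F (x + 1) - F x \<longrightarrow>
            e \<le> norm ((F (y + 1) - F y) - (F (x + 1) - F x))"
    proof (intro exI[of _ 1] conjI allI impI)
      fix y assume "y \<in> UNIV \<and> F (y + 1) - F y \<noteq> F (x + 1) - F x"
      then have "(F (y + 1) - F y) - (F (x + 1) - F x) \<in> \<int>"
        "(F (y + 1) - F y) - (F (x + 1) - F x) \<noteq> 0" using int by (auto intro: Ints_diff)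
      then show "1 \<le> norm ((F (y + 1) - F y) - (F (x + 1) - F x))"
        by (simp add: Ints_nonzero_abs_ge1)
    qed simp
  qed
  then obtain c where c: "\<And>x. F (x + 1) - F x = c" by (auto simp: constant_on_def)
  with int[of 0] obtain d :: int where "c = of_int d" by (metis Ints_cases)
  then show ?thesis using c by (metis add.commute diff_add_cancel)
qed

lemma F_degree_nat:
  assumes "\<And>x. F (x + 1) = F x + of_int d"
  shows "F (x + real n) = F x + real n * of_int d"
proof (induction n)
  case (Suc n)
  have "F (x + real (Suc n)) = F ((x + real n) + 1)" by (simp add: algebra_simps)
  then show ?case unfolding assms Suc by (simp add: algebra_simps)
qed simp

text \<open>A coincidence \<open>F s = F t\<close> makes the degree vanish, so \<open>F\<close> has
  period 1. It must then take some value twice within one period, at points that are less than 1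
  apart.\<close>

lemma F_inj: "inj F"
proof (rule injI, rule ccontr)
  fix s t assume eq: "F s = F t" and ne: "s \<noteq> t"
  obtain d where d: "\<And>x. F (x + 1) = F x + of_int d" using F_degree by blast
  obtain s' t' where st: "s' < t'" "F s' = F t'"
    using eq ne that[of s t] that[of t s] by (cases "s < t") auto
  have "t' - s' \<in> \<int>" using F_Ints_diff[of t' s'] st by simp
  then obtain i where i: "t' - s' = of_int i" by (auto elim: Ints_cases)
  define n where "n = nat i"
  have "i > 0" using i st by linarith
  then have n: "t' = s' + real n" "n > 0" using i by (auto simp: n_def)
  have "real n * of_int d = 0" using F_degree_nat[OF d, of s' n] st n by simp
  then have d0: "F (x + 1) = F x" for x using d n by simp
  have contF: "continuous_on X F" for X by (rule continuous_on_subset[OF cont]) auto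
  \<comment> \<open>The midpoint of the distinct values \<open>F 0\<close> and
    \<open>F (1/2)\<close> is taken on both halves of the period, and away from the
    endpoints.\<close>
  define m where "m = (F 0 + F (1/2)) / 2"
  have ne: "F 0 \<noteq> F (1/2)" by (rule F_no_short_return) auto
  have F1: "F 1 = F 0" using d0[of 0] by simp
  have "\<exists>x\<ge>0. x \<le> 1/2 \<and> F x = m"
  proof (cases "F 0 \<le> F (1/2)")
    case True then show ?thesis by (intro IVT') (auto simp: m_def contF)
  next
    case False then show ?thesis by (intro IVT2') (auto simp: m_def contF)
  qed
  then obtain x where x: "0 \<le> x" "x \<le> 1/2" "F x = m" by auto
  have "\<exists>x\<ge>1/2. x \<le> 1 \<and> F x = m"
  proof (cases "F 0 \<le> F (1/2)")
    case True then show ?thesis by (intro IVT2') (auto simp: m_def contF F1)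
  next
    case False then show ?thesis by (intro IVT') (auto simp: m_def contF F1)
  qed
  then obtain y where y: "1/2 \<le> y" "y \<le> 1" "F y = m" by auto
  have "m \<noteq> F 0" "m \<noteq> F (1/2)" "m \<noteq> F 1" using ne F1 by (auto simp: m_def)
  then have "x \<noteq> 0" "x \<noteq> 1/2" "y \<noteq> 1" "y \<noteq> 1/2" using x y by metis+
  then show False using F_no_short_return[of x y] x y by auto
qed

text \<open>An injective continuous function is monotone on every triple of points. The order of
  \<open>F 0\<close> and \<open>F 1\<close> fixes the direction and is carried over to any pair
  \<open>x < y\<close> through a window that contains all four points.\<close>

lemma F_mono_or_antimono: "strict_mono F \<or> (\<forall>x y. x < y \<longrightarrow> F y < F x)"
proof -
  have c: "continuous_on X F" for X by (rule continuous_on_subset[OF cont]) auto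
  have i: "inj_on F X" for X by (rule inj_on_subset[OF F_inj]) auto
  have mono: "(F x < F y \<and> F y < F z) \<or> (F x > F y \<and> F y > F z)" if "x < y" "y < z" for x y z
    using continuous_inj_imp_mono[OF that c i] by auto
  consider "F 0 < F 1" | "F 1 < F 0" using F_inj by (metis injD linorder_neqE_linordered_idom zero_neq_one)
  then show ?thesis
  proof cases
    case 1
    have "F x < F y" if "x < y" for x y
    proof -
      define l where "l = min x 0 - 1"
      define r where "r = max y 1 + 1"
      have "l < 0" by (simp add: l_def)
      then have "F l < F 1 \<and> F l < F 0" using 1 mono[of l 0 1] by auto
      moreover have "l < 1" "1 < r" by (auto simp: l_def r_def)
      ultimately have "F l < F r" using mono[of l 1 r] by auto
      moreover have "l < x" "x < r" using that by (auto simp: l_def r_def)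
      ultimately have "F x < F r" "F l < F x" using mono[of l x r] by auto
      then show ?thesis using mono[of x y r] that \<open>x < r\<close> by (force simp: r_def)
    qed
    then show ?thesis by (auto intro!: strict_monoI)
  next
    case 2
    have "F x > F y" if "x < y" for x y
    proof -
      define l where "l = min x 0 - 1"
      define r where "r = max y 1 + 1"
      have "l < 0" by (simp add: l_def)
      then have "F l > F 1 \<and> F l > F 0" using 2 mono[of l 0 1] by auto
      moreover have "l < 1" "1 < r" by (auto simp: l_def r_def)
      ultimately have "F l > F r" using mono[of l 1 r] by auto
      moreover have "l < x" "x < r" using that by (auto simp: l_def r_def)
      ultimately have "F x > F r" "F l > F x" using mono[of l x r] by auto
      then show ?thesis using mono[of x y r] that \<open>x < r\<close> by (force simp: r_def)
    qed
    then show ?thesis by auto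
  qed
qed

text \<open>If the degree were at least 2 in absolute value, \<open>F\<close> would pass a value
  differing by 1 from \<open>F 0\<close> somewhere on the unit interval. Such a point is an integer,
  hence 0 or 1, which bounds the degree by 1.\<close>

lemma F_degree_abs:
  assumes d: "\<And>x. F (x + 1) = F x + of_int d"
  shows "\<bar>d\<bar> = 1"
proof -
  have contF: "continuous_on X F" for X by (rule continuous_on_subset[OF cont]) auto
  have F1: "F 1 = F 0 + of_int d" using d[of 0] by simp
  have "d \<noteq> 0" using F1 injD[OF F_inj, of 1 0] by auto
  show ?thesis
  proof (rule ccontr)
    assume "\<bar>d\<bar> \<noteq> 1"
    with \<open>d \<noteq> 0\<close> consider "d \<ge> 2" | "d \<le> -2" by linarith
    then have "\<exists>x\<ge>0. x \<le> 1 \<and> (F x = F 0 + 1 \<or> F x = F 0 - 1)"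
    proof cases
      case 1
      then have "F 0 \<le> F 0 + 1" "F 0 + 1 \<le> F 1" using F1 by auto
      then show ?thesis using IVT'[of F 0 "F 0 + 1" 1] contF by auto
    next
      case 2
      then have "real_of_int d \<le> -2" by linarith
      then have "F 1 \<le> F 0 - 1" "F 0 - 1 \<le> F 0" using F1 by auto
      then show ?thesis using IVT2'[of F 1 "F 0 - 1" 0] contF by auto
    qed
    then obtain x where x: "0 \<le> x" "x \<le> 1" "F x = F 0 + 1 \<or> F x = F 0 - 1" by auto
    then have "F x - F 0 \<in> \<int>" by auto
    then have "x \<in> \<int>" using F_Ints_diff[of x 0] by simp
    then have "x = 0 \<or> x = 1" using x by (auto elim!: Ints_cases)
    then have "\<bar>real_of_int d\<bar> \<le> 1" using x F1 by auto
    then show False using \<open>d \<noteq> 0\<close> \<open>\<bar>d\<bar> \<noteq> 1\<close> by linarith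
  qed
qed

text \<open>A decreasing lift has a fixed point \<open>x0\<close> and exchanges
  \<open>x0 + n\<close> with \<open>x0 - n\<close>. The orbit of 0 is then bounded, so the rotation
  number is 0, which is rational.\<close>

lemma F_strict_mono: "strict_mono F"
proof (rule ccontr)
  assume "\<not> strict_mono F"
  then have anti: "F y < F x" if "x < y" for x y using F_mono_or_antimono that by blast
  obtain d where d: "\<And>x. F (x + 1) = F x + of_int d" using F_degree by blast
  have "of_int d < (0::real)" using anti[of 0 1] d[of 0] by simp
  then have d1: "d = -1" using F_degree_abs[OF d] by simp
  have contF: "continuous_on X F" for X by (rule continuous_on_subset[OF cont]) auto
  \<comment> \<open>Large enough for \<open>F x - x\<close> to change sign between \<open>-k\<close>
    and \<open>k\<close>.\<close>
  define k where "k = \<bar>F 0\<bar> + 1"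
  have k0: "k > 0" by (simp add: k_def)
  have "F k - k \<le> 0" using anti[of 0 k] k0 by (simp add: k_def)
  moreover have "0 \<le> F (-k) - (-k)" using anti[of "-k" 0] k0 by (simp add: k_def)
  ultimately have "\<exists>x\<ge>-k. x \<le> k \<and> F x - x = 0"
    using k0 by (intro IVT2' continuous_intros contF) auto
  then obtain x0 where x0: "F x0 = x0" by auto
  obtain n :: nat where n: "real n > \<bar>x0\<bar>" using reals_Archimedean2 by blast
  have up: "F (x0 + real n) = x0 - real n" using F_degree_nat[OF d, of x0 n] x0 d1 by simp
  have lo: "F (x0 - real n) = x0 + real n"
    using F_degree_nat[OF d, of "x0 - real n" n] x0 d1 by simp
  have bd: "\<bar>(F ^^ i) 0 - x0\<bar> \<le> real n" for i
  proof (induction i)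
    case 0 then show ?case using n by simp
  next
    case (Suc i)
    define z where "z = (F ^^ i) 0"
    have z: "x0 - real n \<le> z" "z \<le> x0 + real n" using Suc by (auto simp: z_def)
    have am: "x \<le> y \<Longrightarrow> F y \<le> F x" for x y using anti[of x y] by (cases "x = y") auto
    have "F z \<le> x0 + real n" "x0 - real n \<le> F z"
      using am[OF z(1)] am[OF z(2)] lo up by auto
    then show ?case by (simp add: z_def abs_le_iff)
  qed
  have "(\<lambda>i. (F ^^ i) 0 / real i) \<longlonglongrightarrow> 0"
  proof (rule Lim_null_comparison)
    show "\<forall>\<^sub>F i in sequentially. norm ((F ^^ i) 0 / real i) \<le> (\<bar>x0\<bar> + real n) / real i"
    proof (intro always_eventually allI)
      fix i
      have "\<bar>(F ^^ i) 0\<bar> \<le> \<bar>x0\<bar> + real n" using bd[of i] by linarith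
      then show "norm ((F ^^ i) 0 / real i) \<le> (\<bar>x0\<bar> + real n) / real i"
        by (simp add: divide_right_mono)
    qed
    show "(\<lambda>i. (\<bar>x0\<bar> + real n) / real i) \<longlonglongrightarrow> 0"
      by (rule lim_const_over_n)
  qed
  then have "\<rho> = 0" using lim LIMSEQ_unique by blast
  then show False using irr by simp
qed

lemma F_add_one: "F (x + 1) = F x + 1"
proof -
  obtain d where d: "\<And>x. F (x + 1) = F x + of_int d" using F_degree by blast
  have "F 0 < F 1" using F_strict_mono by (simp add: strict_mono_def)
  then have "(0::real) < of_int d" using d[of 0] by simp
  then have "d = 1" using F_degree_abs[OF d] by simp
  then show ?thesis using d by simp
qed

lemma F_add_int: "F (x + of_int n) = F x + of_int n"
proof -
  have nat: "F (y + real m) = F y + real m" for y m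
    using F_degree_nat[of 1 y m] F_add_one by simp
  show ?thesis
  proof (cases n)
    case (nonneg m) then show ?thesis using nat by simp
  next
    case (neg m)
    have "F x = F (x - real (Suc m)) + real (Suc m)" using nat[of "x - real (Suc m)" "Suc m"] by simp
    moreover have "of_int n = - real (Suc m)" using neg by simp
    ultimately show ?thesis by (metis add_diff_cancel_right' diff_conv_add_uminus)
  qed
qed

lemma F_surj: "surj F"
proof -
  have contF: "continuous_on X F" for X by (rule continuous_on_subset[OF cont]) auto
  have "\<exists>x. F x = y" for y
  proof -
    define n where "n = \<lfloor>y - F 0\<rfloor>"
    have "F (0 + of_int n) \<le> y" "y \<le> F (0 + of_int (n + 1))"
      unfolding F_add_int n_def by linarith+
    then have "\<exists>x\<ge>of_int n. x \<le> of_int (n+1) \<and> F x = y"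
      by (intro IVT') (auto simp: contF)
    then show ?thesis by auto
  qed
  then show ?thesis by (metis surjI)
qed

end

section \<open>The semiconjugacy with a rotation\<close>

lemma irrational_mult_dist_Ints:
  fixes \<rho> :: real
  assumes "\<rho> \<notin> \<rat>" "m > 0"
  shows "\<exists>e>0. \<forall>j::int. e \<le> \<bar>real m * \<rho> - of_int j\<bar>"
proof (intro exI[of _ "min (frac (real m * \<rho>)) (1 - frac (real m * \<rho>))"] conjI allI)
  have "real m * \<rho> \<notin> \<int>"
  proof
    assume "real m * \<rho> \<in> \<int>"
    then have "real m * \<rho> / real m \<in> \<rat>" by (intro Rats_divide) (auto simp: Ints_subset_Rats[THEN subsetD])
    then show False using assms by simp
  qed
  then show "0 < min (frac (real m * \<rho>)) (1 - frac (real m * \<rho>))"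
    by (simp add: frac_gt_0_iff frac_lt_1)
  fix j :: int
  have "j \<le> \<lfloor>real m * \<rho>\<rfloor> \<or> j \<ge> \<lfloor>real m * \<rho>\<rfloor> + 1" by linarith
  then have "real_of_int j \<le> of_int \<lfloor>real m * \<rho>\<rfloor> \<or> real_of_int j \<ge> of_int \<lfloor>real m * \<rho>\<rfloor> + 1" by linarith
  then show "min (frac (real m * \<rho>)) (1 - frac (real m * \<rho>)) \<le> \<bar>real m * \<rho> - of_int j\<bar>"
    using frac_lt_1[of "real m * \<rho>"] by (auto simp: frac_def)
qed

text \<open>Let \<open>e\<close> be a lower bound for the distances of the first \<open>N\<close>
  multiples of \<rho> to the integers. The first \<open>q\<close> that comes closer than
  \<open>e\<close> exceeds \<open>N\<close> and beats every earlier time.\<close>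

lemma closest_return_time:
  fixes \<rho> :: real
  assumes "\<rho> \<notin> \<rat>"
  shows "\<exists>q>N. \<exists>p::int. \<forall>m. 0 < m \<and> m < q \<longrightarrow> (\<forall>j::int. \<bar>real q * \<rho> - p\<bar> < \<bar>real m * \<rho> - j\<bar>)"
proof -
  have "\<exists>e>0. \<forall>m. 0 < m \<and> m \<le> N \<longrightarrow> (\<forall>j::int. e \<le> \<bar>real m * \<rho> - of_int j\<bar>)"
  proof (induction N)
    case 0 show ?case by (intro exI[of _ 1]) auto
  next
    case (Suc N)
    then obtain e where e: "e > 0" "\<And>m j::int. 0 < m \<Longrightarrow> m \<le> N \<Longrightarrow> e \<le> \<bar>real m * \<rho> - of_int j\<bar>" by blast
    obtain e' where e': "e' > 0" "\<And>j::int. e' \<le> \<bar>real (Suc N) * \<rho> - of_int j\<bar>"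
      using irrational_mult_dist_Ints[OF assms, of "Suc N"] by blast
    show ?case
    proof (intro exI[of _ "min e e'"] conjI allI impI)
      fix m and j :: int assume "0 < m \<and> m \<le> Suc N"
      then show "min e e' \<le> \<bar>real m * \<rho> - of_int j\<bar>"
        using e(2)[of m j] e'(2)[of j] by (cases "m = Suc N") auto
    qed (use e e' in auto)
  qed
  then obtain e where e: "e > 0" "\<And>m j::int. 0 < m \<Longrightarrow> m \<le> N \<Longrightarrow> e \<le> \<bar>real m * \<rho> - of_int j\<bar>" by blast
  define P where "P q \<longleftrightarrow> q > 0 \<and> (\<exists>p::int. \<bar>real q * \<rho> - p\<bar> < e)" for q
  obtain k h where kh: "k > 0" "\<bar>of_int k * \<rho> - of_int h - 0\<bar> < e"
    using sequence_of_fractional_parts_is_dense[OF assms e(1)] by metis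
  then have "P (nat k)" by (auto simp: P_def intro!: exI[of _ h])
  then have P: "P (LEAST q. P q)" by (rule LeastI)
  define q where "q = (LEAST q. P q)"
  obtain p :: int where p: "q > 0" "\<bar>real q * \<rho> - p\<bar> < e" using P by (auto simp: P_def q_def)
  show ?thesis
  proof (intro exI[of _ q] exI[of _ p] conjI allI impI)
    show "N < q" using p e(2)[of q p] by (cases "q \<le> N") auto
    fix m and j :: int assume m: "0 < m \<and> m < q"
    then have "\<not> P m" unfolding q_def using not_less_Least by blast
    then have "e \<le> \<bar>real m * \<rho> - j\<bar>" using m by (auto simp: P_def not_less)
    then show "\<bar>real q * \<rho> - p\<bar> < \<bar>real m * \<rho> - j\<bar>" using p(2) by linarith
  qed
qed

lemma irrational_mult_Ints:
  fixes \<rho> :: real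
  assumes "\<rho> \<notin> \<rat>" "of_int k * \<rho> \<in> \<int>"
  shows "k = 0"
proof (rule ccontr)
  assume "k \<noteq> 0"
  have "of_int k * \<rho> / of_int k \<in> \<rat>"
    using assms(2) by (intro Rats_divide) (auto simp: Ints_subset_Rats[THEN subsetD])
  then show False using assms(1) \<open>k \<noteq> 0\<close> by simp
qed

text \<open>Integer translations bring the left endpoints into \<open>[0, 1)\<close>. The open
  intervals become disjoint subsets of \<open>[0, 2]\<close>, because each has length at most
  1.\<close>

lemma sum_lengths_disjoint_mod_one:
  fixes l r :: "'i \<Rightarrow> real"
  assumes fin: "finite I"
    and len: "\<And>i. i \<in> I \<Longrightarrow> l i \<le> r i \<and> r i \<le> l i + 1"
    and disj: "\<And>i k t s. \<lbrakk>i \<in> I; k \<in> I; i \<noteq> k; l i < t; t < r i; l k < s; s < r k; t - s \<in> \<int>\<rbrakk> \<Longrightarrow> False"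
  shows "(\<Sum>i\<in>I. r i - l i) \<le> 2"
proof -
  define A where "A i = {l i - of_int \<lfloor>l i\<rfloor> <..< r i - of_int \<lfloor>l i\<rfloor>}" for i
  have m: "measure lborel (A i) = r i - l i" if "i \<in> I" for i
    using len[OF that] by (simp add: A_def)
  have dj: "disjoint_family_on A I"
    unfolding disjoint_family_on_def
  proof (intro ballI impI)
    fix i k assume ik: "i \<in> I" "k \<in> I" "i \<noteq> k"
    show "A i \<inter> A k = {}"
    proof (rule ccontr)
      assume "A i \<inter> A k \<noteq> {}"
      then obtain x where x: "x \<in> A i" "x \<in> A k" by auto
      have "(x + of_int \<lfloor>l i\<rfloor>) - (x + of_int \<lfloor>l k\<rfloor>) = of_int (\<lfloor>l i\<rfloor> - \<lfloor>l k\<rfloor>)" by simp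
      then have "(x + of_int \<lfloor>l i\<rfloor>) - (x + of_int \<lfloor>l k\<rfloor>) \<in> \<int>" by (metis Ints_of_int)
      then show False
        using disj[OF ik, of "x + of_int \<lfloor>l i\<rfloor>" "x + of_int \<lfloor>l k\<rfloor>"] x by (auto simp: A_def)
    qed
  qed
  have sub: "(\<Union>i\<in>I. A i) \<subseteq> {0..2}"
  proof
    fix x assume "x \<in> (\<Union>i\<in>I. A i)"
    then obtain i where i: "i \<in> I" "x \<in> A i" by auto
    then show "x \<in> {0..2}" using len[OF i(1)] by (auto simp: A_def) linarith+
  qed
  have "(\<Sum>i\<in>I. r i - l i) = (\<Sum>i\<in>I. measure lborel (A i))" using m by simp
  also have "\<dots> = measure lborel (\<Union>i\<in>I. A i)"
  proof (rule measure_finite_Union[symmetric, OF fin])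
    show "A ` I \<subseteq> sets lborel" by (auto simp: A_def)
    show "emeasure lborel (A i) \<noteq> \<infinity>" if "i \<in> I" for i
      using len[OF that] by (simp add: A_def)
  qed (rule dj)
  also have "\<dots> \<le> measure lborel {0..2::real}"
    using sub by (intro measure_mono_fmeasurable) (auto simp: A_def fin fmeasurable_def intro!: sets.finite_UN)
  finally show ?thesis by simp
qed

lemma Sup_translate:
  assumes "S \<noteq> {}" "bdd_above S"
  shows "Sup ((\<lambda>z. z + c) ` S) = Sup S + (c::real)"
proof (rule cSup_eq_non_empty)
  fix y assume y: "\<And>x. x \<in> (\<lambda>z. z + c) ` S \<Longrightarrow> x \<le> y"
  have "Sup S \<le> y - c"
    using assms(1) y by (intro cSup_least) (auto simp: le_diff_eq)
  then show "Sup S + c \<le> y" by simp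
qed (use assms in \<open>auto intro: cSup_upper\<close>)

section \<open>Bounded deviation from the rotation, and the semiconjugacy \<open>h\<close>\<close>

context lifted_map
begin

lemma F_less_iff [simp]: "F x < F y \<longleftrightarrow> x < y"
  using F_strict_mono by (simp add: strict_mono_less)

lemma F_le_iff [simp]: "F x \<le> F y \<longleftrightarrow> x \<le> y"
  using F_strict_mono by (simp add: strict_mono_less_eq)

lemma Fn_less_iff [simp]: "(F ^^ n) x < (F ^^ n) y \<longleftrightarrow> x < y"
  by (induction n) auto

lemma Fn_le_iff [simp]: "(F ^^ n) x \<le> (F ^^ n) y \<longleftrightarrow> x \<le> y"
  by (induction n) auto

lemma Fn_add_int: "(F ^^ n) (x + of_int k) = (F ^^ n) x + of_int k"
  by (induction n) (auto simp: F_add_int)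

lemma Fn_surj: "\<exists>y. (F ^^ n) y = x"
proof (induction n)
  case (Suc n)
  then obtain y where "(F ^^ n) y = x" by auto
  moreover obtain z where "F z = y" using F_surj by (metis surjD)
  ultimately show ?case by (auto simp: funpow_Suc_right simp del: funpow.simps)
qed simp

text \<open>Displacement has period 1, so \<open>x\<close> may be moved by an integer to within
  distance 1 of \<open>y\<close>; monotonicity does the rest.\<close>

lemma Fn_displacement_diff: "(F ^^ n) y - y \<le> (F ^^ n) x - x + 1"
proof -
  define k where "k = \<lfloor>y - x\<rfloor>"
  have k: "x + of_int k \<le> y" "y \<le> x + of_int k + 1"
    using floor_correct[of "y - x"] unfolding k_def by linarith+
  have "(F ^^ n) y \<le> (F ^^ n) (x + of_int (k + 1))" using k by (simp add: add.assoc)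
  also have "\<dots> = (F ^^ n) x + of_int k + 1" unfolding Fn_add_int by simp
  finally show ?thesis using k by simp
qed

text \<open>Each block of \<open>n\<close> steps displaces the orbit of 0 by the displacement
  \<open>d\<close> of \<open>x\<close> up to an error of 1. Averaging over \<open>k\<close> blocks
  and letting \<open>k\<close> grow puts \<open>n\<close> times \<rho> between \<open>d - 1\<close>
  and \<open>d + 1\<close>.\<close>

lemma Fn_deviation: "\<bar>(F ^^ n) x - x - real n * \<rho>\<bar> \<le> 1"
proof (cases "n = 0")
  case False
  define d where "d = (F ^^ n) x - x"
  have bd: "real k * (d - 1) \<le> (F ^^ (n * k)) 0 \<and> (F ^^ (n * k)) 0 \<le> real k * (d + 1)" for k
  proof (induction k)
    case (Suc k)
    define z where "z = (F ^^ (n * k)) 0"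
    have "(F ^^ (n * Suc k)) 0 = (F ^^ n) z" by (simp add: z_def funpow_add)
    moreover have "(F ^^ n) z - z \<le> d + 1" "d - 1 \<le> (F ^^ n) z - z"
      using Fn_displacement_diff[of n z x] Fn_displacement_diff[of n x z] by (auto simp: d_def)
    ultimately show ?case using Suc by (simp add: z_def algebra_simps)
  qed simp
  have "strict_mono (\<lambda>k. n * k)" using False by (auto intro!: strict_monoI)
  then have "((\<lambda>m. (F ^^ m) 0 / real m) \<circ> (\<lambda>k. n * k)) \<longlonglongrightarrow> \<rho>"
    using lim by (rule LIMSEQ_subseq_LIMSEQ[rotated])
  then have l: "(\<lambda>k. (F ^^ (n * k)) 0 / real (n * k)) \<longlonglongrightarrow> \<rho>" by (simp add: o_def)
  have "\<rho> \<le> (d + 1) / real n"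
  proof (rule LIMSEQ_le_const2[OF l], intro exI[of _ 1] allI impI)
    fix k :: nat assume k: "k \<ge> 1"
    have "(F ^^ (n * k)) 0 / real (n * k) \<le> (real k * (d + 1)) / real (n * k)"
      using bd[of k] by (intro divide_right_mono) auto
    then show "(F ^^ (n * k)) 0 / real (n * k) \<le> (d + 1) / real n"
      using k by simp
  qed
  moreover have "(d - 1) / real n \<le> \<rho>"
  proof (rule LIMSEQ_le_const[OF l], intro exI[of _ 1] allI impI)
    fix k :: nat assume k: "k \<ge> 1"
    have "(real k * (d - 1)) / real (n * k) \<le> (F ^^ (n * k)) 0 / real (n * k)"
      using bd[of k] by (intro divide_right_mono) auto
    then show "(d - 1) / real n \<le> (F ^^ (n * k)) 0 / real (n * k)"
      using k by simp
  qed
  ultimately show ?thesis using False by (simp add: d_def field_simps abs_le_iff)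
qed simp

text \<open>If \<open>F\<close> were the translation by \<open>\<rho>\<close>, every element of \<open>orb x\<close> would equal \<open>x\<close>. Running over past and future
  (via \<open>F\<^sup>m y = F\<^sup>n x\<close>) makes the supremum exactly equivariant.\<close>
definition orb :: "real \<Rightarrow> real set" where
  "orb x = {y + (real m - real n) * \<rho> | m n y. (F ^^ m) y = (F ^^ n) x}"

definition h :: "real \<Rightarrow> real" where
  "h x = Sup (orb x)"

lemma orb_self: "x \<in> orb x"
  unfolding orb_def by (intro CollectI exI[of _ 0] exI[of _ x]) auto

text \<open>The deviation bound is used twice, once along \<open>y\<close> and once along
  \<open>x\<close>; hence the 2.\<close>

lemma orb_bdd: "bdd_above (orb x)"
proof (rule bdd_aboveI)
  fix z assume "z \<in> orb x"
  then obtain m n y where z: "z = y + (real m - real n) * \<rho>" "(F ^^ m) y = (F ^^ n) x"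
    by (auto simp: orb_def)
  then show "z \<le> x + 2"
    using Fn_deviation[of m y] Fn_deviation[of n x] by (auto simp: abs_le_iff algebra_simps)
qed

lemma h_mono: "x \<le> x' \<Longrightarrow> h x \<le> h x'"
  unfolding h_def
proof (rule cSup_mono)
  show "orb x \<noteq> {}" using orb_self by auto
  fix z assume le: "x \<le> x'" and "z \<in> orb x"
  then obtain m n y where z: "z = y + (real m - real n) * \<rho>" "(F ^^ m) y = (F ^^ n) x"
    by (auto simp: orb_def)
  obtain y' where y': "(F ^^ m) y' = (F ^^ n) x'" using Fn_surj by blast
  have "(F ^^ m) y \<le> (F ^^ m) y'" using y' z le by simp
  then have "y \<le> y'" by simp
  then show "\<exists>w\<in>orb x'. z \<le> w"
    using y' z(1) by (intro bexI[of _ "y' + (real m - real n) * \<rho>"]) (auto simp: orb_def)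
qed (rule orb_bdd)

text \<open>The two orbit sets are translates of each other: raising \<open>n\<close> by one gives
  one inclusion, raising \<open>m\<close> by one the other.\<close>

lemma h_F: "h (F x) = h x + \<rho>"
proof -
  have "orb (F x) = (\<lambda>z. z + \<rho>) ` orb x"
  proof (intro equalityI subsetI)
    fix z assume "z \<in> orb (F x)"
    then obtain m n y where z: "z = y + (real m - real n) * \<rho>" "(F ^^ m) y = (F ^^ n) (F x)"
      by (auto simp: orb_def)
    then have "(F ^^ m) y = (F ^^ Suc n) x" by (metis comp_apply funpow_Suc_right)
    then have "y + (real m - real (Suc n)) * \<rho> \<in> orb x" unfolding orb_def by blast
    moreover have "z = (y + (real m - real (Suc n)) * \<rho>) + \<rho>" using z by (simp add: algebra_simps)
    ultimately show "z \<in> (\<lambda>z. z + \<rho>) ` orb x" by blast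
  next
    fix z assume "z \<in> (\<lambda>z. z + \<rho>) ` orb x"
    then obtain m n y where z: "z = y + (real m - real n) * \<rho> + \<rho>" "(F ^^ m) y = (F ^^ n) x"
      by (auto simp: orb_def)
    then have "(F ^^ Suc m) y = (F ^^ n) (F x)" by (simp add: funpow_swap1)
    then have "y + (real (Suc m) - real n) * \<rho> \<in> orb (F x)" unfolding orb_def by blast
    moreover have "z = y + (real (Suc m) - real n) * \<rho>" using z by (simp add: algebra_simps)
    ultimately show "z \<in> orb (F x)" by simp
  qed
  then show ?thesis unfolding h_def using Sup_translate orb_self orb_bdd by (metis empty_iff)
qed

lemma h_add_int: "h (x + of_int k) = h x + of_int k"
proof -
  have sub: "(\<lambda>z. z + of_int k) ` orb x \<subseteq> orb (x + of_int k)" for x k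
  proof
    fix z assume "z \<in> (\<lambda>z. z + of_int k) ` orb x"
    then obtain m n y where z: "z = y + (real m - real n) * \<rho> + of_int k" "(F ^^ m) y = (F ^^ n) x"
      by (auto simp: orb_def)
    then have "(F ^^ m) (y + of_int k) = (F ^^ n) (x + of_int k)" by (simp add: Fn_add_int)
    then have "(y + of_int k) + (real m - real n) * \<rho> \<in> orb (x + of_int k)" unfolding orb_def by blast
    moreover have "z = (y + of_int k) + (real m - real n) * \<rho>" using z by simp
    ultimately show "z \<in> orb (x + of_int k)" by simp
  qed
  have ge: "h x + of_int k \<le> h (x + of_int k)" for x k
  proof -
    have "h x + of_int k = Sup ((\<lambda>z. z + of_int k) ` orb x)"
      unfolding h_def using Sup_translate orb_self orb_bdd by (metis empty_iff)
    also have "\<dots> \<le> h (x + of_int k)"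
      unfolding h_def using sub orb_bdd orb_self by (intro cSup_subset_mono) force+
    finally show ?thesis .
  qed
  \<comment> \<open>The inequality for \<open>-k\<close> at the point \<open>x + of_int k\<close> is
    the reverse one.\<close>
  show ?thesis using ge[of x k] ge[of "x + of_int k" "-k"] by simp
qed

lemma h_Fn: "h ((F ^^ n) x) = h x + real n * \<rho>"
  by (induction n) (auto simp: h_F algebra_simps)

end

section \<open>Denjoy's theorem for the map\<close>

lemma Tab_Lipschitz:
  "norm (Tab a b p - Tab a b q) \<le> (\<bar>a\<bar> + \<bar>b\<bar> + 2) * norm (p - q)"
proof -
  obtain x y where p: "p = (x, y)" by (cases p)
  obtain x' y' where q: "q = (x', y')" by (cases q)
  define g where "g t = (if t \<ge> 0 then a * t else b * t)" for t
  have T: "Tab a b p - Tab a b q = ((g x - g x') - (y - y'), x - x')"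
    by (auto simp: Tab_def p q g_def)
  \<comment> \<open>For arguments of opposite sign the two branches are compared through their
    common value at 0.\<close>
  have aux: "\<bar>a * s - b * t\<bar> \<le> (\<bar>a\<bar> + \<bar>b\<bar>) * \<bar>s - t\<bar>" if "s \<ge> 0" "t < 0" for s t
  proof -
    have "\<bar>a * s - b * t\<bar> \<le> \<bar>a\<bar> * s + \<bar>b\<bar> * (- t)"
      using that by (metis abs_mult abs_of_neg abs_of_nonneg abs_triangle_ineq4)
    also have "\<dots> \<le> \<bar>a\<bar> * (s - t) + \<bar>b\<bar> * (s - t)"
      using that by (intro add_mono mult_left_mono) auto
    finally show ?thesis using that by (simp add: algebra_simps)
  qed
  have same: "\<bar>c * s - c * t\<bar> \<le> (\<bar>a\<bar> + \<bar>b\<bar>) * \<bar>s - t\<bar>" if "c = a \<or> c = b" for c s t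
  proof -
    have "\<bar>c * s - c * t\<bar> = \<bar>c\<bar> * \<bar>s - t\<bar>" by (metis abs_mult right_diff_distrib)
    also have "\<dots> \<le> (\<bar>a\<bar> + \<bar>b\<bar>) * \<bar>s - t\<bar>" using that by (intro mult_right_mono) auto
    finally show ?thesis .
  qed
  have g: "\<bar>g x - g x'\<bar> \<le> (\<bar>a\<bar> + \<bar>b\<bar>) * \<bar>x - x'\<bar>"
    using same[of a x x'] same[of b x x'] aux[of x x'] aux[of x' x]
    by (auto simp: g_def abs_minus_commute)
  have dx: "\<bar>x - x'\<bar> \<le> norm (p - q)" and dy: "\<bar>y - y'\<bar> \<le> norm (p - q)"
    using norm_fst_le[of "x - x'" "y - y'"] norm_snd_le[of "y - y'" "x - x'"] by (auto simp: p q)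
  have "norm (Tab a b p - Tab a b q) \<le> \<bar>(g x - g x') - (y - y')\<bar> + \<bar>x - x'\<bar>"
    unfolding T using norm_Pair_le[of "(g x - g x') - (y - y')" "x - x'"] by simp
  also have "\<dots> \<le> (\<bar>a\<bar> + \<bar>b\<bar>) * \<bar>x - x'\<bar> + \<bar>y - y'\<bar> + \<bar>x - x'\<bar>"
    using g by linarith
  also have "\<dots> \<le> (\<bar>a\<bar> + \<bar>b\<bar>) * norm (p - q) + norm (p - q) + norm (p - q)"
    using dx dy by (intro add_mono mult_left_mono) auto
  finally show ?thesis by (simp add: algebra_simps)
qed

lemma norm_le_norm_Tab: "norm p \<le> (\<bar>a\<bar> + \<bar>b\<bar> + 2) * norm (Tab a b p)"
proof -
  obtain x y where q: "Tab a b p = (x, y)" by (cases "Tab a b p")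
  define c where "c = (if y \<ge> 0 then a else b)"
  have p: "p = (y, c * y - x)"
    using Tinv_Tab[of a b p] by (auto simp: q Tinv_def c_def)
  have x: "\<bar>x\<bar> \<le> norm (Tab a b p)" and y: "\<bar>y\<bar> \<le> norm (Tab a b p)"
    using norm_fst_le[of x y] norm_snd_le[of y x] by (auto simp: q)
  have "norm p \<le> \<bar>y\<bar> + \<bar>c * y - x\<bar>"
    unfolding p using norm_Pair_le[of y "c * y - x"] by simp
  also have "\<dots> \<le> \<bar>y\<bar> + (\<bar>c\<bar> * \<bar>y\<bar> + \<bar>x\<bar>)"
    using abs_triangle_ineq4[of "c * y" x] by (simp add: abs_mult)
  also have "\<dots> \<le> norm (Tab a b p) + ((\<bar>a\<bar> + \<bar>b\<bar>) * norm (Tab a b p) + norm (Tab a b p))"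
    using x y by (intro add_mono mult_mono) (auto simp: c_def)
  finally show ?thesis by (simp add: algebra_simps)
qed

lemma circ_Lipschitz: "norm (circ s - circ t) \<le> 4 * pi * \<bar>s - t\<bar>"
proof -
  have c: "\<bar>cos x - cos y\<bar> \<le> \<bar>x - y\<bar>" for x y :: real
  proof -
    have "\<bar>cos x - cos y\<bar> = 2 * (\<bar>sin ((x + y) / 2)\<bar> * \<bar>sin ((y - x) / 2)\<bar>)"
      by (simp add: cos_diff_cos abs_mult)
    also have "\<dots> \<le> 2 * (1 * \<bar>(y - x) / 2\<bar>)"
      by (intro mult_left_mono mult_mono abs_sin_le_one abs_sin_x_le_abs_x) auto
    finally show ?thesis by simp
  qed
  have s: "\<bar>sin x - sin y\<bar> \<le> \<bar>x - y\<bar>" for x y :: real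
    using c[of "pi / 2 - x" "pi / 2 - y"] by (simp add: cos_diff abs_minus_commute)
  have e: "\<bar>2 * pi * s - 2 * pi * t\<bar> = 2 * pi * \<bar>s - t\<bar>"
    by (metis abs_mult abs_of_pos pi_gt_zero right_diff_distrib zero_less_mult_iff zero_less_numeral)
  have "norm (circ s - circ t) \<le> \<bar>cos (2 * pi * s) - cos (2 * pi * t)\<bar> + \<bar>sin (2 * pi * s) - sin (2 * pi * t)\<bar>"
    unfolding circ_def using norm_Pair_le[of "cos (2 * pi * s) - cos (2 * pi * t)" "sin (2 * pi * s) - sin (2 * pi * t)"] by simp
  then show ?thesis using c[of "2 * pi * s" "2 * pi * t"] s[of "2 * pi * s" "2 * pi * t"] e by linarith
qed

definition det2 :: "real \<times> real \<Rightarrow> real \<times> real \<Rightarrow> real" where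
  "det2 p q = fst p * snd q - snd p * fst q"

lemma det2_circ: "det2 (r *\<^sub>R circ s) (r' *\<^sub>R circ t) = r * r' * sin (2 * pi * (t - s))"
  by (simp add: det2_def circ_def sin_diff algebra_simps)

text \<open>On either half plane the map is linear with matrix rows \<open>(c, -1)\<close> and
  \<open>(1, 0)\<close>, of determinant 1; the sign condition puts both vectors on the same
  branch.\<close>

lemma det2_Tab:
  "0 \<le> fst p \<and> 0 \<le> fst q \<or> fst p < 0 \<and> fst q < 0 \<Longrightarrow> det2 (Tab a b p) (Tab a b q) = det2 p q"
  by (auto simp: det2_def Tab_def algebra_simps)

lemma cos_two_pi_eq_zeroD:
  assumes "cos (2 * pi * w) = 0"
  shows "\<exists>c\<in>{1/4, 3/4}. \<exists>j::int. w = c + of_int j"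
proof -
  obtain i :: int where i: "odd i" "2 * pi * w = of_int i * (pi / 2)"
    using assms by (auto simp: cos_zero_iff_int)
  then have w: "w = of_int i / 4" by (simp add: field_simps)
  obtain k where k: "i = 2 * k + 1" using i(1) by (auto elim: oddE)
  show ?thesis
  proof (cases "even k")
    case True
    then obtain j where "k = 2 * j" by (auto elim: evenE)
    then show ?thesis using w k by (intro bexI[of _ "1/4"] exI[of _ j]) auto
  next
    case False
    then obtain j where "k = 2 * j + 1" by (auto elim: oddE)
    then show ?thesis using w k by (intro bexI[of _ "3/4"] exI[of _ j]) auto
  qed
qed

section \<open>Bounded distortion at closest return times\<close>

context lifted_map
begin

definition N :: "real \<Rightarrow> real" where
  "N s = norm (T (circ s))"

lemma N_pos: "N s > 0"
  by (simp add: N_def)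

lemma N_add_int: "N (s + of_int j) = N s"
  by (simp add: N_def circ_add_int)

text \<open>A Lipschitz constant for the logarithm of \<open>N\<close>: one factor
  \<open>\<bar>a\<bar> + \<bar>b\<bar> + 2\<close> bounds the variation of the map, the other the
  reciprocal of \<open>N\<close>, and \<open>4 * pi\<close> comes from \<open>circ\<close>.\<close>

definition L where "L = (\<bar>a\<bar> + \<bar>b\<bar> + 2)\<^sup>2 * (4 * pi)"

lemma L_nonneg: "L \<ge> 0"
  by (simp add: L_def)

lemma N_le_exp: "N s \<le> N t * exp (L * \<bar>s - t\<bar>)"
proof -
  define K where "K = \<bar>a\<bar> + \<bar>b\<bar> + 2"
  have K: "K > 0" by (simp add: K_def)
  have low: "1 \<le> K * N t" using norm_le_norm_Tab[of "circ t" a b] by (simp add: N_def K_def)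
  have "N s - N t \<le> norm (T (circ s) - T (circ t))"
    unfolding N_def by (rule norm_triangle_ineq2)
  also have "\<dots> \<le> K * norm (circ s - circ t)" unfolding K_def by (rule Tab_Lipschitz)
  also have "\<dots> \<le> K * (4 * pi * \<bar>s - t\<bar>)"
    using K circ_Lipschitz by (intro mult_left_mono) auto
  \<comment> \<open>Inserting the factor \<open>K * N t\<close>, which is at least 1, turns the
    absolute bound into one relative to \<open>N t\<close>.\<close>
  also have "\<dots> \<le> (K * (4 * pi * \<bar>s - t\<bar>)) * (K * N t)"
    using low K mult_left_mono[of 1 "K * N t" "K * (4 * pi * \<bar>s - t\<bar>)"] by simp
  also have "\<dots> = N t * (L * \<bar>s - t\<bar>)" by (simp add: L_def K_def power2_eq_square)
  finally have "N s \<le> N t * (1 + L * \<bar>s - t\<bar>)" by (simp add: algebra_simps)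
  also have "\<dots> \<le> N t * exp (L * \<bar>s - t\<bar>)"
    using N_pos[of t] by (intro mult_left_mono exp_ge_add_one_self) auto
  finally show ?thesis .
qed

text \<open>The factor by which \<open>T ^^ q\<close> stretches the direction \<open>s\<close>,
  written as a product along the orbit so that distortion can be estimated factor by factor.\<close>

definition R :: "nat \<Rightarrow> real \<Rightarrow> real" where
  "R q s = (\<Prod>i<q. N ((F ^^ i) s))"

lemma R_pos: "R q s > 0"
  by (simp add: R_def N_pos prod_pos)

lemma Tn_circ: "(T ^^ q) (circ s) = R q s *\<^sub>R circ ((F ^^ q) s)"
proof (induction q)
  case (Suc q)
  then have "(T ^^ Suc q) (circ s) = R q s *\<^sub>R T (circ ((F ^^ q) s))"
    using R_pos by (simp add: Tab_scaleR)
  also have "T (circ ((F ^^ q) s)) = N ((F ^^ q) s) *\<^sub>R circ ((F ^^ Suc q) s)"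
    using T_circ by (simp add: N_def)
  finally show ?case by (simp add: R_def)
qed (simp add: R_def)

lemma h_diff_of_int:
  assumes "t - s = of_int j"
  shows "h t - h s = of_int j"
  using h_add_int[of s j] assms by (metis add.commute add_diff_cancel_left' diff_add_cancel)

text \<open>Denjoy's distortion estimate: at a closest return time \<open>q\<close> the intervals between
  \<open>F\<^sup>i z\<close> and \<open>F\<^sup>i\<^sup>+\<^sup>q z - p\<close> for \<open>i < q\<close> are disjoint modulo 1.\<close>
lemma R_distortion:
  assumes q: "q > 1"
    and rec: "\<And>m (j::int). 0 < m \<Longrightarrow> m < q \<Longrightarrow> \<bar>real q * \<rho> - of_int p\<bar> < \<bar>real m * \<rho> - of_int j\<bar>"
  shows "R q ((F ^^ q) z) \<le> exp (2 * L) * R q z"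
proof -
  define u where "u i = (F ^^ i) z" for i
  define v where "v i = (F ^^ i) ((F ^^ q) z) - of_int p" for i
  define \<delta> where "\<delta> = real q * \<rho> - of_int p"
  have hu: "h (u i) = h z + real i * \<rho>" for i by (simp add: u_def h_Fn)
  have hv: "h (v i) = h z + real i * \<rho> + \<delta>" for i
    using h_diff_of_int[of "v i + of_int p" "v i" p] by (simp add: v_def h_Fn \<delta>_def)
  \<comment> \<open>Time 1 is among the earlier times that \<open>q\<close> beats, since
    \<open>q > 1\<close>.\<close>
  have \<delta>1: "\<bar>\<delta>\<bar> < 1"
  proof -
    have "\<bar>\<delta>\<bar> < \<bar>\<rho> - of_int \<lfloor>\<rho>\<rfloor>\<bar>" using rec[of 1 "\<lfloor>\<rho>\<rfloor>"] q by (simp add: \<delta>_def)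
    also have "\<dots> < 1" by linarith
    finally show ?thesis .
  qed
  \<comment> \<open>By monotonicity \<open>h\<close> sends the interval between \<open>u i\<close>
    and \<open>v i\<close> into the segment with ends \<open>h (u i)\<close> and
    \<open>h (v i)\<close>, here described by midpoint and radius.\<close>
  have between: "\<bar>h t - (h z + real i * \<rho> + \<delta> / 2)\<bar> \<le> \<bar>\<delta>\<bar> / 2"
    if "min (u i) (v i) < t" "t < max (u i) (v i)" for t i
  proof (cases "u i \<le> v i")
    case True
    then have "h (u i) \<le> h t" "h t \<le> h (v i)" using that by (auto intro: h_mono)
    then show ?thesis unfolding hu hv by (auto simp: abs_le_iff field_simps)
  next
    case False
    then have "h (v i) \<le> h t" "h t \<le> h (u i)" using that by (auto intro: h_mono)
    then show ?thesis unfolding hu hv by (auto simp: abs_le_iff field_simps)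
  qed
  have "(\<Sum>i<q. max (u i) (v i) - min (u i) (v i)) \<le> 2"
  proof (rule sum_lengths_disjoint_mod_one)
    fix i
    have "\<not> v i \<ge> u i + 1"
      using h_mono[of "u i + of_int 1" "v i"] \<delta>1 unfolding hu hv h_add_int by auto
    moreover have "\<not> u i \<ge> v i + 1"
      using h_mono[of "v i + of_int 1" "u i"] \<delta>1 unfolding hu hv h_add_int by auto
    ultimately show "min (u i) (v i) \<le> max (u i) (v i) \<and> max (u i) (v i) \<le> min (u i) (v i) + 1"
      by (auto simp: min_def max_def)
  next
    fix i k t s
    assume ik: "i \<in> {..<q}" "k \<in> {..<q}" "i \<noteq> k"
      and t: "min (u i) (v i) < t" "t < max (u i) (v i)"
      and s: "min (u k) (v k) < s" "s < max (u k) (v k)"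
      and "t - s \<in> \<int>"
    then obtain j :: int where j: "t - s = of_int j" by (auto elim: Ints_cases)
    have hj: "h t - h s = of_int j" using j by (rule h_diff_of_int)
    \<comment> \<open>A common point modulo 1 of the intervals numbered \<open>i\<close> and
      \<open>k\<close> would give a return at time \<open>\<bar>i - k\<bar> < q\<close> that is at
      least as close as the one at \<open>q\<close>.\<close>
    have le: "\<bar>(real i - real k) * \<rho> - of_int j\<bar> \<le> \<bar>\<delta>\<bar>"
    proof -
      have "(real i - real k) * \<rho> - of_int j =
          (h s - (h z + real k * \<rho> + \<delta> / 2)) - (h t - (h z + real i * \<rho> + \<delta> / 2))"
        unfolding hj[symmetric] by (simp add: algebra_simps)
      then show ?thesis using between[OF t] between[OF s] by linarith
    qed
    show False
    proof (cases "i > k")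
      case True
      then have "\<bar>\<delta>\<bar> < \<bar>real (i - k) * \<rho> - of_int j\<bar>"
        unfolding \<delta>_def using ik by (intro rec) auto
      then show False using le True by (simp add: of_nat_diff)
    next
      case False
      then have "\<bar>\<delta>\<bar> < \<bar>real (k - i) * \<rho> - of_int (- j)\<bar>"
        unfolding \<delta>_def using ik by (intro rec) auto
      then show False using le False by (simp add: of_nat_diff algebra_simps)
    qed
  qed simp
  moreover have "max x y - min x y = \<bar>y - x\<bar>" for x y :: real by (simp add: max_def min_def)
  ultimately have sum: "(\<Sum>i<q. \<bar>v i - u i\<bar>) \<le> 2" by simp
  have "R q ((F ^^ q) z) = (\<Prod>i<q. N (v i))"
    unfolding R_def v_def by (intro prod.cong refl) (metis N_add_int diff_add_cancel)
  also have "\<dots> \<le> (\<Prod>i<q. N (u i) * exp (L * \<bar>v i - u i\<bar>))"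
    using N_pos by (intro prod_mono conjI N_le_exp) (auto intro: less_imp_le)
  also have "\<dots> = R q z * exp (L * (\<Sum>i<q. \<bar>v i - u i\<bar>))"
    by (simp add: prod.distrib R_def u_def exp_sum sum_distrib_left)
  also have "\<dots> \<le> R q z * exp (L * 2)"
  proof -
    have "L * (\<Sum>i<q. \<bar>v i - u i\<bar>) \<le> L * 2"
      using sum L_nonneg by (rule mult_left_mono)
    then show ?thesis using R_pos[of q z] by (intro mult_left_mono) auto
  qed
  finally show ?thesis by (simp add: mult.commute)
qed

text \<open>A zero of the cosine means that a forward image of the interval meets a vertical ray,
  where the two branches of \<open>T\<close> join.\<close>

definition no_break :: "real \<Rightarrow> real \<Rightarrow> bool" where
  "no_break x y \<longleftrightarrow> (\<forall>i. \<forall>z. x \<le> z \<and> z \<le> y \<longrightarrow> cos (2 * pi * (F ^^ i) z) \<noteq> 0)"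

text \<open>By the intermediate value theorem the first coordinate keeps its sign on each image of
  the interval, so both end vectors always use the same branch, of determinant 1.\<close>

lemma no_break_det2:
  assumes "no_break x y" "x \<le> y"
  shows "det2 ((T ^^ n) (circ x)) ((T ^^ n) (circ y)) = sin (2 * pi * (y - x))"
proof (induction n)
  case 0 then show ?case using det2_circ[of 1 x 1 y] by simp
next
  case (Suc n)
  define f where "f s = cos (2 * pi * s)" for s :: real
  have nz: "f w \<noteq> 0" if "(F ^^ n) x \<le> w" "w \<le> (F ^^ n) y" for w
  proof -
    obtain z where z: "(F ^^ n) z = w" using Fn_surj by blast
    then show ?thesis using that assms(1) by (auto simp: no_break_def f_def)
  qed
  have le: "(F ^^ n) x \<le> (F ^^ n) y" using assms(2) by simp
  have contf: "continuous_on {(F ^^ n) x..(F ^^ n) y} f"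
    unfolding f_def by (intro continuous_intros)
  have sgn: "0 \<le> f ((F ^^ n) x) \<and> 0 \<le> f ((F ^^ n) y) \<or> f ((F ^^ n) x) < 0 \<and> f ((F ^^ n) y) < 0"
  proof (cases "f ((F ^^ n) x) < 0")
    case True
    have "\<not> 0 \<le> f ((F ^^ n) y)"
    proof
      assume "0 \<le> f ((F ^^ n) y)"
      then obtain w where "(F ^^ n) x \<le> w" "w \<le> (F ^^ n) y" "f w = 0"
        using IVT'[of f, OF _ _ le contf, of 0] True by auto
      then show False using nz by blast
    qed
    then show ?thesis using True by auto
  next
    case False
    have "\<not> f ((F ^^ n) y) < 0"
    proof
      assume "f ((F ^^ n) y) < 0"
      then obtain w where "(F ^^ n) x \<le> w" "w \<le> (F ^^ n) y" "f w = 0"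
        using IVT2'[of f, OF _ _ le contf, of 0] False by auto
      then show False using nz by blast
    qed
    then show ?thesis using False by auto
  qed
  have fst: "fst ((T ^^ n) (circ s)) = R n s * f ((F ^^ n) s)" for s
    unfolding Tn_circ by (simp add: circ_def f_def)
  have "det2 (T ((T ^^ n) (circ x))) (T ((T ^^ n) (circ y))) = det2 ((T ^^ n) (circ x)) ((T ^^ n) (circ y))"
    using sgn R_pos[of n x] R_pos[of n y]
    by (intro det2_Tab) (auto simp: fst mult_pos_neg)
  then show ?case using Suc by simp
qed

section \<open>Absence of wandering intervals\<close>

lemma irr_unique:
  assumes "(real n - real m) * \<rho> - of_int j = (real n' - real m') * \<rho> - of_int j'"
  shows "n + m' = n' + m" "j = j'"
proof -
  have "of_int ((int n - int m) - (int n' - int m')) * \<rho> = of_int (j - j')"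
    using assms by (simp add: algebra_simps)
  then have *: "(int n - int m) - (int n' - int m') = 0"
    by (intro irrational_mult_Ints[OF irr]) (metis Ints_of_int)
  then show "n + m' = n' + m" by linarith
  have "real n - real m = real n' - real m'" using * by linarith
  then show "j = j'" using assms by simp
qed

lemma Fn_inject [simp]: "(F ^^ n) x = (F ^^ n) y \<longleftrightarrow> x = y"
  by (simp add: order.eq_iff)

text \<open>Two points of the full orbit of \<open>w\<close> modulo 1 with the same value of
  \<open>h\<close> have, by irrationality, the same time shift and the same integer shift, so they
  coincide. The set has at most one element.\<close>

lemma finite_break_orbit:
  assumes const: "\<And>z. z \<in> Z \<Longrightarrow> h z = c"
  shows "finite {z \<in> Z. \<exists>n m (j::int). (F ^^ n) z = (F ^^ m) w + of_int j}" (is "finite ?B")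
proof -
  have uniq: "z = z'" if z: "z \<in> ?B" and z': "z' \<in> ?B" for z z'
  proof -
    obtain n m j where e: "z \<in> Z" "(F ^^ n) z = (F ^^ m) w + of_int j" using z by blast
    obtain n' m' j' where e': "z' \<in> Z" "(F ^^ n') z' = (F ^^ m') w + of_int j'" using z' by blast
    have "c + real n * \<rho> = h w + real m * \<rho> + of_int j"
      using arg_cong[OF e(2), of h] const[OF e(1)] by (simp add: h_Fn h_add_int)
    moreover have "c + real n' * \<rho> = h w + real m' * \<rho> + of_int j'"
      using arg_cong[OF e'(2), of h] const[OF e'(1)] by (simp add: h_Fn h_add_int)
    ultimately have "(real n - real m) * \<rho> - of_int j = (real n' - real m') * \<rho> - of_int j'"
      by (simp add: algebra_simps)
    then have nm: "n + m' = n' + m" "j = j'" by (rule irr_unique)+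
    have "(F ^^ (m' + n)) z = (F ^^ (m' + m)) w + of_int j"
      using e by (simp add: funpow_add Fn_add_int)
    moreover have "(F ^^ (m + n')) z' = (F ^^ (m + m')) w + of_int j"
      using e' nm by (simp add: funpow_add Fn_add_int)
    ultimately have "(F ^^ (m' + n)) z = (F ^^ (m' + n)) z'" using nm(1) by (simp add: add.commute)
    then show ?thesis by simp
  qed
  show ?thesis
  proof (cases "?B = {}")
    case False
    then obtain z where "z \<in> ?B" by blast
    then have "?B \<subseteq> {z}" using uniq by blast
    then show ?thesis using finite_subset by blast
  next
    case True
    then show ?thesis by (metis finite.emptyI)
  qed
qed

text \<open>An interval on which \<open>h\<close> is constant contains a smaller one whose full
  orbit avoids the breaks. Determinants are then conserved both \<open>q\<close> steps forward and
  \<open>q\<close> steps back. At a closest return time the distortion bound links the two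
  stretchings, which contradicts the shrinking of the forward angles.\<close>

lemma h_strict_mono: "strict_mono h"
proof (rule ccontr)
  assume "\<not> strict_mono h"
  then obtain x0 y0 where xy0: "x0 < y0" "\<not> h x0 < h y0" by (auto simp: strict_mono_def)
  have const: "h z = h x0" if "x0 \<le> z" "z \<le> y0" for z
    using h_mono[OF that(1)] h_mono[OF that(2)] xy0 by linarith
  \<comment> \<open>Allowing iterates on both sides covers hits of the break \<open>w\<close> in the
    past as well as in the future.\<close>
  define Bd where "Bd w = {z \<in> {x0..y0}. \<exists>n m (j::int). (F ^^ n) z = (F ^^ m) w + of_int j}" for w
  have "finite (Bd w)" for w
    unfolding Bd_def by (rule finite_break_orbit[where c = "h x0"]) (rule const; simp)
  then have fin: "finite (Bd (1/4) \<union> Bd (3/4))" by blast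
  then have "open ({x0<..<y0} - (Bd (1/4) \<union> Bd (3/4)))"
    by (intro open_Diff finite_imp_closed) auto
  moreover have "{x0<..<y0} - (Bd (1/4) \<union> Bd (3/4)) \<noteq> {}"
    using xy0(1) fin by (metis Diff_eq_empty_iff finite_subset infinite_Ioo)
  ultimately obtain x e where x: "e > 0" "ball x e \<subseteq> {x0<..<y0} - (Bd (1/4) \<union> Bd (3/4))"
    by (meson all_not_in_conv openE)
  \<comment> \<open>The bound \<open>e / 2\<close> keeps \<open>[x, y]\<close> inside the ball;
    \<open>1 / 4\<close> keeps the sine of the angle between the end directions positive.\<close>
  define y where "y = x + min (e / 2) (1 / 4)"
  have xy: "x < y" "y \<le> x + 1 / 4" "y < x + e" using x(1) by (auto simp: y_def)
  have xy_sub: "x0 < z \<and> z < y0 \<and> z \<notin> Bd (1/4) \<union> Bd (3/4)" if "x \<le> z" "z \<le> y" for z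
    using x(2) that xy by (auto simp: subset_iff dist_real_def)
  have nb: "no_break x' y'" if "(F ^^ q) x' = x" "(F ^^ q) y' = y" for x' y' q
    unfolding no_break_def
  proof (intro allI impI notI)
    fix i z assume z: "x' \<le> z \<and> z \<le> y'" and "cos (2 * pi * (F ^^ i) z) = 0"
    then obtain c j where c: "c \<in> {1/4, 3/4}" "(F ^^ i) z = c + of_int j"
      using cos_two_pi_eq_zeroD by blast
    define w where "w = (F ^^ q) z"
    have w: "x \<le> w" "w \<le> y" using z that by (auto simp: w_def simp flip: that)
    have "(F ^^ i) w = (F ^^ q) c + of_int j"
      unfolding w_def by (metis c(2) Fn_add_int add.commute comp_apply funpow_add)
    then have "w \<in> Bd c" using xy_sub[OF w] unfolding Bd_def by (auto intro: less_imp_le)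
    then show False using xy_sub[OF w] c(1) by blast
  qed
  define \<alpha> where "\<alpha> q = (F ^^ q) y - (F ^^ q) x" for q
  have \<alpha>_pos: "\<alpha> q > 0" for q using xy by (simp add: \<alpha>_def)
  \<comment> \<open>On the image numbered \<open>i\<close> the value of \<open>h\<close> is
    \<open>h x0 + real i * \<rho>\<close>, so irrationality makes different images disjoint modulo
    1.\<close>
  have "(\<Sum>q<n. \<alpha> q) \<le> 2" for n
    unfolding \<alpha>_def
  proof (rule sum_lengths_disjoint_mod_one)
    fix i
    have "(F ^^ i) y \<le> (F ^^ i) (x + of_int 1)" using xy by simp
    then show "(F ^^ i) x \<le> (F ^^ i) y \<and> (F ^^ i) y \<le> (F ^^ i) x + 1"
      using xy unfolding Fn_add_int by simp
  next
    fix i k t s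
    assume ik: "i \<noteq> k"
      and t: "(F ^^ i) x < t" "t < (F ^^ i) y" and s: "(F ^^ k) x < s" "s < (F ^^ k) y"
      and "t - s \<in> \<int>"
    then obtain j :: int where j: "t - s = of_int j" by (auto elim: Ints_cases)
    have eq: "h t' = h x0 + real i * \<rho>" if "(F ^^ i) x < t'" "t' < (F ^^ i) y" for t' i
    proof -
      have "h ((F ^^ i) x) \<le> h t'" "h t' \<le> h ((F ^^ i) y)" using that by (auto intro: h_mono)
      then show ?thesis using const[of x] const[of y] xy_sub[of x] xy_sub[of y] xy unfolding h_Fn by linarith
    qed
    have "(real i - real k) * \<rho> - of_int j = (real 0 - real 0) * \<rho> - of_int 0"
      using h_diff_of_int[OF j] eq[OF t] eq[OF s] by (simp add: algebra_simps)
    then have "i + 0 = 0 + k" by (rule irr_unique)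
    then show False using ik by simp
  qed auto
  then have "summable \<alpha>"
    using \<alpha>_pos by (intro summableI_nonneg_bounded[of _ 2]) (auto intro: less_imp_le)
  then have lim0: "\<alpha> \<longlonglongrightarrow> 0" by (rule summable_LIMSEQ_zero)
  define C where "C = exp (2 * L)"
  define s0 where "s0 = sin (2 * pi * (y - x))"
  have C: "C > 0" by (simp add: C_def)
  have s0: "s0 > 0" unfolding s0_def
  proof (rule sin_gt_zero)
    have "y - x < 1 / 2" using xy by linarith
    then have "2 * pi * (y - x) < 2 * pi * (1 / 2)" by (intro mult_strict_left_mono) auto
    then show "2 * pi * (y - x) < pi" by simp
  qed (use xy in simp)
  have "0 < s0\<^sup>2 / (C\<^sup>2 * (2 * pi))" using s0 C by simp
  then obtain n0 where n0: "\<And>n. n \<ge> n0 \<Longrightarrow> \<alpha> n < s0\<^sup>2 / (C\<^sup>2 * (2 * pi))"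
    using order_tendstoD(2)[OF lim0] by (auto simp: eventually_sequentially)
  \<comment> \<open>The extra 1 ensures \<open>q > 1\<close>, which the distortion estimate
    requires.\<close>
  obtain q p where qp: "q > n0 + 1"
    "\<And>m (j::int). 0 < m \<Longrightarrow> m < q \<Longrightarrow> \<bar>real q * \<rho> - of_int p\<bar> < \<bar>real m * \<rho> - of_int j\<bar>"
    using closest_return_time[OF irr, of "n0 + 1"] by blast
  obtain x' where x': "(F ^^ q) x' = x" using Fn_surj by blast
  obtain y' where y': "(F ^^ q) y' = y" using Fn_surj by blast
  have "(F ^^ q) x' < (F ^^ q) y'" using x' y' xy by simp
  then have xy': "x' < y'" by simp
  have dist: "R q x \<le> C * R q x'" "R q y \<le> C * R q y'"
    using R_distortion[of q p x'] R_distortion[of q p y'] qp x' y' by (auto simp: C_def)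
  \<comment> \<open>Conservation from time \<open>-q\<close> to time 0; the sine on the right bounds
    the product of the backward stretchings.\<close>
  have "R q x' * R q y' * s0 = sin (2 * pi * (y' - x'))"
    using no_break_det2[OF nb[OF x' y'], of q] xy' by (simp add: Tn_circ det2_circ x' y' s0_def)
  then have small: "R q x' * R q y' * s0 \<le> 1" by simp
  have nb0: "no_break x y" using nb[of 0 x y] by simp
  have "s0 = R q x * R q y * sin (2 * pi * \<alpha> q)"
    using no_break_det2[OF nb0, of q] xy by (simp add: Tn_circ det2_circ s0_def \<alpha>_def)
  also have "\<dots> \<le> R q x * R q y * (2 * pi * \<alpha> q)"
    using R_pos[of q x] R_pos[of q y] \<alpha>_pos[of q] by (intro mult_left_mono sin_x_le_x) auto
  also have "\<dots> \<le> (C * R q x') * (C * R q y') * (2 * pi * \<alpha> q)"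
    using dist R_pos[of q x] R_pos[of q y] \<alpha>_pos[of q] C R_pos[of q x']
    by (intro mult_right_mono mult_mono) auto
  \<comment> \<open>The additional factor \<open>s0\<close> completes the product that
    \<open>small\<close> bounds by 1.\<close>
  finally have "s0 * s0 \<le> ((C * R q x') * (C * R q y') * (2 * pi * \<alpha> q)) * s0"
    using s0 by (intro mult_right_mono) auto
  also have "\<dots> = (R q x' * R q y' * s0) * (C\<^sup>2 * (2 * pi * \<alpha> q))" by (simp add: power2_eq_square)
  also have "\<dots> \<le> 1 * (C\<^sup>2 * (2 * pi * \<alpha> q))"
    using small C \<alpha>_pos[of q] by (intro mult_right_mono) auto
  finally have "s0\<^sup>2 / (C\<^sup>2 * (2 * pi)) \<le> \<alpha> q"
    using C by (simp add: field_simps power2_eq_square)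
  then show False using n0[of q] qp(1) by simp
qed

end

section \<open>First returns and cutting rays\<close>

lemma break_nonzero: "(0 :: real, 1 :: real) \<noteq> 0" "(0 :: real, - 1 :: real) \<noteq> 0"
  by (simp_all add: zero_prod_def)

lemma frac_eqI: "x - y \<in> \<int> \<Longrightarrow> frac x = frac (y::real)"
  by (metis Ints_cases diff_add_cancel add.commute frac_add_int_right)

section \<open>Cyclic order in the coordinate where the map is a rotation\<close>

context lifted_map
begin

text \<open>\<open>ang\<close> is a fixed branch of the angle, so relations between values of
  \<open>H\<close> hold up to integers; \<open>g\<close> removes the ambiguity by passing to
  fractional parts.\<close>

definition H :: "real \<times> real \<Rightarrow> real" where
  "H p = h (ang p)"

definition g :: "real \<times> real \<Rightarrow> real \<times> real \<Rightarrow> real" where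
  "g p q = frac (H q - H p)"

lemma g_range: "0 \<le> g p q" "g p q < 1"
  by (auto simp: g_def frac_lt_1)

lemma h_diff_Ints: "s - t \<in> \<int> \<Longrightarrow> h s - h t = s - t"
  by (metis Ints_cases h_diff_of_int)

lemma H_T:
  assumes "p \<noteq> 0"
  shows "H (T p) - (H p + \<rho>) \<in> \<int>"
proof -
  have "T p = norm p *\<^sub>R T (circ (ang p))"
    using circ_ang[of p] assms Tab_scaleR[of "norm p" a b "circ (ang p)"] by simp
  also have "\<dots> = (norm p * N (ang p)) *\<^sub>R circ (F (ang p))"
    using arg_cong[OF T_circ, of "\<lambda>q. norm p *\<^sub>R q" "ang p"] by (simp add: N_def)
  finally have "ang (T p) - F (ang p) \<in> \<int>"
    using assms N_pos[of "ang p"] by (intro ang_eqI[of "norm p * N (ang p)"]) auto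
  then show ?thesis using h_diff_Ints by (auto simp: H_def h_F[symmetric])
qed

lemma H_Tn:
  assumes "p \<noteq> 0"
  shows "H ((T ^^ n) p) - (H p + real n * \<rho>) \<in> \<int>"
proof (induction n)
  case (Suc n)
  have "H (T ((T ^^ n) p)) - (H ((T ^^ n) p) + \<rho>) \<in> \<int>" using assms by (intro H_T) simp
  from Ints_add[OF this Suc] show ?case by (simp add: algebra_simps)
qed simp

lemma g_Tn:
  assumes "p \<noteq> 0" "q \<noteq> 0"
  shows "g ((T ^^ n) p) ((T ^^ n) q) = g p q"
  unfolding g_def using Ints_diff[OF H_Tn[OF assms(2), of n] H_Tn[OF assms(1), of n]]
  by (intro frac_eqI) (simp add: algebra_simps)

text \<open>One turn starting at \<open>ang v\<close> is mapped by \<open>h\<close> into a window of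
  length 1, where \<open>frac\<close> changes nothing. For fixed \<open>v\<close> this makes
  \<open>g v\<close> a strictly increasing function of the angle, so sectors can be described by
  \<open>g\<close>, which the iterates preserve.\<close>

lemma g_eq_h: "g v w = h (ang v + ccw_angle v w) - h (ang v)"
proof -
  define c where "c = ccw_angle v w"
  have c: "0 \<le> c" "c < 1" by (auto simp: c_def ccw_angle_ang frac_lt_1)
  have "ang w - (ang v + c) \<in> \<int>" by (simp add: c_def ccw_angle_ang frac_def)
  then have i: "H w - h (ang v + c) \<in> \<int>" using h_diff_Ints unfolding H_def by metis
  have "h (ang v) \<le> h (ang v + c)" using c by (intro h_mono) auto
  moreover have "h (ang v + c) < h (ang v + of_int 1)"
    using c by (intro strict_monoD[OF h_strict_mono]) simp
  ultimately have r: "0 \<le> h (ang v + c) - H v" "h (ang v + c) - H v < 1"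
    unfolding h_add_int H_def by auto
  have "g v w = frac (h (ang v + c) - H v)"
    unfolding g_def using i by (intro frac_eqI) simp
  also have "\<dots> = h (ang v + c) - H v" using r by (simp add: frac_eq)
  finally show ?thesis by (simp add: c_def H_def)
qed

lemma ccw_less_iff: "ccw_angle v w < ccw_angle v w' \<longleftrightarrow> g v w < g v w'"
  unfolding g_eq_h using h_strict_mono by (simp add: strict_mono_less)

lemma ccw_le_iff: "ccw_angle v w \<le> ccw_angle v w' \<longleftrightarrow> g v w \<le> g v w'"
  using ccw_less_iff by (meson not_less)

lemma ccw_pos_iff: "0 < ccw_angle v w \<longleftrightarrow> 0 < g v w"
  using ccw_less_iff[of v v w] by (simp add: ccw_angle_ang g_def)

lemma in_sector_iff: "w \<in> sector v v' \<longleftrightarrow> w \<noteq> 0 \<and> g v w < g v v'"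
  by (simp add: sector_def ccw_less_iff)

lemma g_trans: "g u w = (if g u v + g v w < 1 then g u v + g v w else g u v + g v w - 1)"
  using frac_add[of "H v - H u" "H w - H v"] by (simp add: g_def)

lemma g_self [simp]: "g p p = 0"
  by (simp add: g_def)

text \<open>The direction of \<open>m\<close> lies in the arc \<open>(p, q]\<close>.\<close>
definition btw :: "real \<times> real \<Rightarrow> real \<times> real \<Rightarrow> real \<times> real \<Rightarrow> bool" where
  "btw p m q \<longleftrightarrow> 0 < g p m \<and> g p m \<le> g p q"

lemma btw_Tn:
  "p \<noteq> 0 \<Longrightarrow> m \<noteq> 0 \<Longrightarrow> q \<noteq> 0 \<Longrightarrow> btw ((T ^^ n) p) ((T ^^ n) m) ((T ^^ n) q) \<longleftrightarrow> btw p m q"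
  by (simp add: btw_def g_Tn)

text \<open>A counterclockwise move into the sector from outside crosses its included boundary ray;
  \<open>btw_exit\<close> is the counterpart for leaving across the excluded one.\<close>

lemma btw_enter:
  assumes "p \<noteq> 0" "p \<notin> sector v v'" "q \<in> sector v v'"
  shows "btw p v q"
proof -
  have *: "g v q < g v v'" "g v v' \<le> g v p" using assms by (auto simp: in_sector_iff)
  then have p: "0 < g v p" using g_range[of v q] by linarith
  have "g p v = 1 - g v p"
    using g_trans[of v v p] g_range[of p v] g_range[of v p] p by (auto split: if_splits)
  moreover have "g p q = (if g p v + g v q < 1 then g p v + g v q else g p v + g v q - 1)"
    by (rule g_trans)
  ultimately show ?thesis using * p g_range[of v p] g_range[of v q] by (auto simp: btw_def)
qed

lemma btw_exit:
  assumes "q \<noteq> 0" "p \<in> sector v v'" "q \<notin> sector v v'"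
  shows "btw p v' q"
proof -
  have *: "g v p < g v v'" "g v v' \<le> g v q" using assms by (auto simp: in_sector_iff)
  have "g p v' = g v v' - g v p" "g p q = g v q - g v p"
    using g_trans[of v v' p] g_trans[of v q p] * g_range[of p v'] g_range[of p q] g_range[of v v']
      g_range[of v q] g_range[of v p]
    by (auto split: if_splits)
  then show ?thesis using * by (auto simp: btw_def)
qed

text \<open>When \<open>p\<close> and \<open>q\<close> appear in order as seen from
  \<open>v\<close>, the arc from \<open>p\<close> to \<open>q\<close> does not wrap around
  \<open>v\<close>, so a direction inside it has an intermediate position.\<close>

lemma btw_le:
  assumes "btw p m q" "g v p \<le> g v q"
  shows "g v p < g v m" "g v m \<le> g v q"
  using assms g_trans[of v m p] g_trans[of v q p] g_range[of p m] g_range[of p q] g_range[of v m]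
      g_range[of v q] g_range[of v p]
  by (auto simp: btw_def split: if_splits)

lemma ex_return:
  assumes "w \<noteq> 0" "0 < g v v'"
  shows "\<exists>k\<ge>1. (T ^^ k) w \<in> sector v v'"
proof -
  define l where "l = g v v'"
  have l: "l / 2 > 0" using assms by (simp add: l_def)
  \<comment> \<open>The target is the middle \<open>l / 2\<close> of the sector and the tolerance
    half its length.\<close>
  obtain k j :: int where k: "k > 0" "\<bar>of_int k * \<rho> - of_int j - (l / 2 - (H w - H v))\<bar> < l / 2"
    using sequence_of_fractional_parts_is_dense[OF irr l] by metis
  define x where "x = of_int k * \<rho> - of_int j + (H w - H v)"
  have x: "0 < x" "x < l" using k(2) unfolding x_def by linarith+
  have "g v ((T ^^ nat k) w) = frac x" unfolding g_def
  proof (rule frac_eqI)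
    have "(H ((T ^^ nat k) w) - (H w + real (nat k) * \<rho>)) + of_int j \<in> \<int>"
      using H_Tn[OF assms(1), of "nat k"] by (intro Ints_add) auto
    then show "H ((T ^^ nat k) w) - H v - x \<in> \<int>"
      using k(1) by (simp add: x_def algebra_simps)
  qed
  also have "frac x = x" using x g_range[of v v'] by (simp add: frac_eq l_def)
  finally show ?thesis using x k(1) assms(1)
    by (intro exI[of _ "nat k"]) (auto simp: in_sector_iff l_def)
qed

end

section \<open>The half planes as sectors between the break rays\<close>

lemma ang_break: "ang (0, 1) = 1/4" "ang (0, -1) = - 1/4"
proof -
  have "Arg \<i> = pi / 2" "Arg (- \<i>) = - pi / 2"
    by (simp_all add: Arg_ii Arg_minus_ii)
  moreover have "Complex 0 1 = \<i>" "Complex 0 (- 1) = - \<i>" by (auto simp: complex_eq_iff)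
  ultimately show "ang (0, 1) = 1/4" "ang (0, -1) = - 1/4" by (simp_all add: ang_def)
qed

lemma sin_two_pi_nonneg: "0 \<le> f \<Longrightarrow> f < 1/2 \<Longrightarrow> 0 \<le> sin (2 * pi * f)"
  using mult_left_mono[of f "1/2" "2 * pi"] by (intro sin_ge_zero) auto

lemma fst_eq_sin_ccw:
  "fst w = norm w * sin (2 * pi * ccw_angle (0, -1) w)"
  "fst w = - norm w * sin (2 * pi * ccw_angle (0, 1) w)"
proof -
  have w: "fst w = norm w * cos (2 * pi * ang w)"
    using arg_cong[OF circ_ang[of w], of fst] by (simp add: circ_def)
  have per: "cos (2 * pi * (x + of_int n)) = cos (2 * pi * x)" for x and n :: int
    using circ_add_int[of "of_int n" x] by (simp add: circ_def)
  have "cos (2 * pi * ang w) = cos (2 * pi * (ccw_angle (0, -1) w - 1/4))"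
    using per[of "ccw_angle (0, -1) w - 1/4" "\<lfloor>ang w + 1/4\<rfloor>"]
    by (simp add: ccw_angle_ang ang_break frac_def)
  also have "2 * pi * (ccw_angle (0, -1) w - 1/4) = 2 * pi * ccw_angle (0, -1) w - pi / 2"
    by (simp add: algebra_simps)
  finally show "fst w = norm w * sin (2 * pi * ccw_angle (0, -1) w)"
    using w by (simp add: cos_diff)
  have "cos (2 * pi * ang w) = cos (2 * pi * (ccw_angle (0, 1) w + 1/4))"
    using per[of "ccw_angle (0, 1) w + 1/4" "\<lfloor>ang w - 1/4\<rfloor>"]
    by (simp add: ccw_angle_ang ang_break frac_def)
  also have "2 * pi * (ccw_angle (0, 1) w + 1/4) = 2 * pi * ccw_angle (0, 1) w + pi / 2"
    by (simp add: algebra_simps)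
  finally show "fst w = - norm w * sin (2 * pi * ccw_angle (0, 1) w)"
    using w by (simp add: cos_add)
qed

lemma half_turn: "ccw_angle (0, 1) (0, -1) = 1/2" "ccw_angle (0, -1) (0, 1) = 1/2"
proof -
  have "frac (- 1/4 - 1/4 :: real) = frac (1/2)" by (rule frac_eqI) simp
  also have "\<dots> = 1/2" by (simp add: frac_eq)
  finally show "ccw_angle (0, 1) (0, -1) = 1/2" "ccw_angle (0, -1) (0, 1) = 1/2"
    by (simp_all add: ccw_angle_ang ang_break frac_eq)
qed

lemma fst_sector_right: "w \<in> sector (0, -1) (0, 1) \<Longrightarrow> 0 \<le> fst w"
  unfolding fst_eq_sin_ccw(1)[of w] sector_def half_turn
  by (intro mult_nonneg_nonneg sin_two_pi_nonneg) (auto simp: ccw_angle_ang)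

lemma fst_sector_left: "w \<in> sector (0, 1) (0, -1) \<Longrightarrow> fst w \<le> 0"
  unfolding fst_eq_sin_ccw(2)[of w] sector_def half_turn
  using mult_nonneg_nonneg[OF norm_ge_zero sin_two_pi_nonneg, of "ccw_angle (0, 1) w" w]
  by (auto simp: ccw_angle_ang)

lemma sector_left_or_right:
  assumes "w \<noteq> 0"
  shows "w \<in> sector (0, -1) (0, 1) \<or> w \<in> sector (0, 1) (0, -1)"
proof -
  define f where "f = frac (ang w + 1/4)"
  have "frac (ang w - 1/4) = frac (f - 1/2)"
    by (rule frac_eqI) (simp add: f_def frac_def)
  moreover have "frac (f - 1/2) = f - 1/2" if "\<not> f < 1/2"
    using that frac_lt_1[of "ang w + 1/4"] by (simp add: frac_eq f_def)
  moreover have "f < 1" by (simp add: f_def frac_lt_1)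
  ultimately have "f < 1/2 \<or> frac (ang w - 1/4) < 1/2" by linarith
  then show ?thesis
    using assms unfolding sector_def half_turn by (simp add: ccw_angle_ang ang_break f_def)
qed

lemma linear_branch: "linear (\<lambda>p. (c * fst p - snd p, fst p :: real))"
  by (rule linearI) (auto simp: algebra_simps)

lemma Tab_funpow_Tinv: "(Tab a b ^^ n) ((Tinv a b ^^ n) p) = p"
  by (induction n arbitrary: p) (auto simp: funpow_swap1)

context lifted_map
begin

text \<open>\<open>P\<close> runs from \<open>w0\<close> to the next cut. It suffices that no
  iterate up to the return time \<open>k\<close> of \<open>w0\<close> carries a mark across between
  \<open>w0\<close> and a point of \<open>P\<close>. A crossing of \<open>m\<close> at time
  \<open>i\<close> pulls back to a point \<open>z\<close> of \<open>J\<close>: either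
  \<open>z\<close> is the first backward hit of \<open>m\<close>, hence a cut, or an earlier hit
  produces a crossing of \<open>v\<close> at a smaller time.\<close>

lemma first_return_linear:
  assumes vv': "v \<noteq> 0" "v' \<noteq> 0" "0 < ccw_angle v v'"
    and J: "J = sector v v'"
    and M: "M = {v, v', T (0, 1), T (0, -1)}"
    and cuts: "\<And>m n. \<lbrakk>m \<in> M; n \<ge> 1; (Ti ^^ n) m \<in> J; \<And>i. 0 < i \<Longrightarrow> i < n \<Longrightarrow> (Ti ^^ i) m \<notin> J\<rbrakk>
                 \<Longrightarrow> ccw_angle v ((Ti ^^ n) m) \<in> C"
    and w0: "w0 \<in> J"
    and P: "P = {w \<in> J. ccw_angle v w0 \<le> ccw_angle v w \<and> (\<forall>c\<in>C. ccw_angle v w0 < c \<longrightarrow> ccw_angle v w < c)}"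
  shows "\<exists>L. linear L \<and> (\<forall>w\<in>P. first_return a b J w = L w)"
proof -
  define k where "k = (LEAST k. k \<ge> 1 \<and> (T ^^ k) w0 \<in> J)"
  have nz0: "w0 \<noteq> 0" using w0 J by (simp add: sector_def)
  have nz: "w \<noteq> 0" if "w \<in> P" for w using that P J by (auto simp: sector_def)
  have Mnz: "m \<noteq> 0" if "m \<in> M" for m using that vv' M break_nonzero by auto
  have "\<exists>k\<ge>1. (T ^^ k) w0 \<in> J"
    unfolding J using ex_return nz0 vv'(3) ccw_pos_iff by blast
  then have k: "k \<ge> 1" "(T ^^ k) w0 \<in> J"
    unfolding k_def by (metis (mono_tags, lifting) LeastI_ex)+
  have k_min: "(T ^^ i) w0 \<notin> J" if "1 \<le> i" "i < k" for i
    using not_less_Least[of i "\<lambda>k. k \<ge> 1 \<and> (T ^^ k) w0 \<in> J"] that by (auto simp: k_def)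
  have no_cross: "\<not> btw ((T ^^ i) w0) m ((T ^^ i) w)"
    if "1 \<le> i" "i \<le> k" "m \<in> M" "w \<in> P" for i m w
    using that
  proof (induction i arbitrary: m w rule: less_induct)
    case (less i)
    show ?case
    proof
      assume "btw ((T ^^ i) w0) m ((T ^^ i) w)"
      moreover define z where "z = (Ti ^^ i) m"
      have z: "(T ^^ i) z = m" "z \<noteq> 0" using Mnz[OF less.prems(3)] by (auto simp: z_def Tab_funpow_Tinv)
      ultimately have b: "btw w0 z w" using btw_Tn[of w0 z w i] nz0 nz[OF less.prems(4)] by simp
      have le: "g v w0 \<le> g v w" "g v w < g v v'"
        using less.prems(4) P J by (auto simp: ccw_le_iff in_sector_iff)
      note zle = btw_le[OF b le(1)]
      have zJ: "z \<in> J" using zle le z by (simp add: J in_sector_iff)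
      have zc: "ccw_angle v w0 < ccw_angle v z" "ccw_angle v z \<le> ccw_angle v w"
        using zle by (simp_all add: ccw_less_iff ccw_le_iff)
      define Q where "Q n \<longleftrightarrow> n \<ge> 1 \<and> (Ti ^^ n) m \<in> J" for n
      define n where "n = (LEAST n. Q n)"
      have Qi: "Q i" using zJ less.prems by (simp add: Q_def z_def)
      have Qn: "Q n" "n \<le> i" unfolding n_def using Qi by (rule LeastI, rule Least_le)
      have Qmin: "(Ti ^^ j) m \<notin> J" if "0 < j" "j < n" for j
        using not_less_Least[of j Q] that by (auto simp: n_def Q_def)
      have cut: "ccw_angle v ((Ti ^^ n) m) \<in> C"
        using cuts[OF less.prems(3)] Qn Qmin by (auto simp: Q_def)
      show False
      proof (cases "n = i")
        case True
        then have "ccw_angle v z \<in> C" using cut by (simp add: z_def)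
        then have "ccw_angle v w < ccw_angle v z" using less.prems(4) zc P by auto
        then show False using zc by simp
      next
        case False
        define j where "j = i - n"
        have j: "1 \<le> j" "j < i" "i = j + n" using False Qn by (auto simp: j_def Q_def)
        have "(T ^^ j) z = (Ti ^^ n) m"
          by (simp add: z_def j(3) funpow_add Tab_funpow_Tinv)
        then have in_J: "(T ^^ j) z \<in> J" using Qn by (simp add: Q_def)
        have zP: "z \<in> P" using zJ zc less.prems(4) unfolding P by fastforce
        \<comment> \<open>The time \<open>j\<close> precedes the return time \<open>k\<close>, so
          \<open>w0\<close> is still outside \<open>J\<close> while \<open>z\<close> is
          inside.\<close>
        have "btw ((T ^^ j) w0) v ((T ^^ j) z)"
          using btw_enter[of "(T ^^ j) w0" v v' "(T ^^ j) z"] k_min[of j] in_J nz0 j less.prems by (simp add: J)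
        then show False using less.IH[of j v z] j less.prems zP M by auto
      qed
    qed
  qed
  have ret: "first_return a b J w = (T ^^ k) w" if w: "w \<in> P" for w
  proof -
    \<comment> \<open>Returning early would mean crossing \<open>v\<close>, and missing
      \<open>J\<close> at time \<open>k\<close> would mean crossing \<open>v'\<close>.\<close>
    have "(LEAST k. k \<ge> 1 \<and> (T ^^ k) w \<in> J) = k"
    proof (rule Least_equality)
      have "(T ^^ k) w \<in> J"
        using btw_exit[of "(T ^^ k) w" "(T ^^ k) w0" v v'] no_cross[of k v' w] k w nz[OF w] M J by auto
      then show "1 \<le> k \<and> (T ^^ k) w \<in> J" using k by simp
    next
      fix i assume i: "1 \<le> i \<and> (T ^^ i) w \<in> J"
      show "k \<le> i"
      proof (rule ccontr)
        assume "\<not> k \<le> i"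
        then have "btw ((T ^^ i) w0) v ((T ^^ i) w)"
          using btw_enter[of "(T ^^ i) w0" v v' "(T ^^ i) w"] k_min[of i] i nz0 by (simp add: J)
        then show False using no_cross[of i v w] i w \<open>\<not> k \<le> i\<close> M by auto
      qed
    qed
    then show ?thesis by (simp add: first_return_def)
  qed
  have "\<exists>L. linear L \<and> (\<forall>w\<in>P. (T ^^ i) w = L w)" if "i \<le> k" for i
    using that
  proof (induction i)
    case 0
    then show ?case by (intro exI[of _ id]) (auto simp: linear_ident)
  next
    case (Suc i)
    then obtain L where L: "linear L" "\<And>w. w \<in> P \<Longrightarrow> (T ^^ i) w = L w" by auto
    \<comment> \<open>Crossing a break at time \<open>i\<close> amounts to crossing its image under
      \<open>T\<close> at time \<open>Suc i\<close>, which is at most \<open>k\<close>; this is why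
      the images serve as marks.\<close>
    have nb: "\<not> btw ((T ^^ i) w0) q ((T ^^ i) w)" if "q \<in> {(0, 1), (0, -1)}" "w \<in> P" for q w
    proof -
      have "\<not> btw ((T ^^ 1) ((T ^^ i) w0)) ((T ^^ 1) q) ((T ^^ 1) ((T ^^ i) w))"
        using no_cross[of "Suc i" "T q" w] that Suc.prems M by auto
      then show ?thesis
        using btw_Tn[of "(T ^^ i) w0" q "(T ^^ i) w" 1] nz0 nz[OF that(2)] that(1) break_nonzero
        by auto
    qed
    have stay: "(T ^^ i) w \<in> sector u u'"
      if "(T ^^ i) w0 \<in> sector u u'" "u' \<in> {(0, 1), (0, -1)}" "w \<in> P" for u u' w
      using btw_exit[of "(T ^^ i) w" "(T ^^ i) w0" u u'] nb[OF that(2,3)] that(1) nz[OF that(3)] by auto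
    have "\<exists>c. \<forall>w\<in>P. (T ^^ Suc i) w = (\<lambda>p. (c * fst p - snd p, fst p)) ((T ^^ i) w)"
    proof (cases "(T ^^ i) w0 \<in> sector (0, -1) (0, 1)")
      case True
      show ?thesis
      proof (intro exI[of _ a] ballI)
        fix w assume "w \<in> P"
        then have "0 \<le> fst ((T ^^ i) w)" using stay[OF True] by (intro fst_sector_right) auto
        then show "(T ^^ Suc i) w = (\<lambda>p. (a * fst p - snd p, fst p)) ((T ^^ i) w)"
          by (simp add: Tab_def)
      qed
    next
      case False
      then have l: "(T ^^ i) w0 \<in> sector (0, 1) (0, -1)"
        using sector_left_or_right[of "(T ^^ i) w0"] nz0 by auto
      show ?thesis
      proof (intro exI[of _ b] ballI)
        fix w assume "w \<in> P"
        \<comment> \<open>The weak inequality suffices because both branches agree where the first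
          coordinate is 0.\<close>
        then have "fst ((T ^^ i) w) \<le> 0" using stay[OF l] by (intro fst_sector_left) auto
        then show "(T ^^ Suc i) w = (\<lambda>p. (b * fst p - snd p, fst p)) ((T ^^ i) w)"
          by (auto simp: Tab_def)
      qed
    qed
    then obtain c where c: "\<And>w. w \<in> P \<Longrightarrow> (T ^^ Suc i) w = (\<lambda>p. (c * fst p - snd p, fst p)) (L w)"
      using L(2) by auto
    show ?case
    proof (intro exI conjI ballI)
      show "linear ((\<lambda>p. (c * fst p - snd p, fst p)) \<circ> L)"
        by (rule linear_compose[OF L(1) linear_branch])
    qed (simp only: c o_def)
  qed
  then show ?thesis using ret by auto
qed

text \<open>Each cut opens the piece that lasts until the next larger cut. The cut at 0 makes these
  pieces cover the sector, so there are at most as many pieces as cuts.\<close>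

lemma pw_linear_of_cuts:
  assumes vv': "v \<noteq> 0" "v' \<noteq> 0" "0 < ccw_angle v v'"
    and C: "finite C" "card C \<le> k" "0 \<in> C"
    and cuts: "\<And>m n. \<lbrakk>m \<in> {v, v', T (0, 1), T (0, -1)}; n \<ge> 1; (Ti ^^ n) m \<in> sector v v';
                 \<And>i. 0 < i \<Longrightarrow> i < n \<Longrightarrow> (Ti ^^ i) m \<notin> sector v v'\<rbrakk>
                 \<Longrightarrow> ccw_angle v ((Ti ^^ n) m) \<in> C"
  shows "pw_linear_sector v v' (first_return a b (sector v v')) k"
proof -
  define I where "I c = {x. c \<le> x \<and> (\<forall>c'\<in>C. c < c' \<longrightarrow> x < c')}" for c :: real
  define P where "P c = {w \<in> sector v v'. ccw_angle v w \<in> I c}" for c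
  have ccw0: "0 \<le> ccw_angle v w" for w by (simp add: ccw_angle_ang)
  have I_disj: "c = c'" if "x \<in> I c" "x \<in> I c'" "c \<in> C" "c' \<in> C" for c c' x
    using that by (fastforce simp: I_def)
  have cover: "\<exists>c\<in>C. x \<in> I c" if "0 \<le> x" for x
  proof -
    define D where "D = {c \<in> C. c \<le> x}"
    have D: "finite D" "D \<noteq> {}" using C that by (auto simp: D_def)
    then have "Max D \<in> D" by (rule Max_in)
    moreover have "x < c'" if "c' \<in> C" "Max D < c'" for c'
      using Max_ge[OF D(1), of c'] that by (force simp: D_def)
    ultimately show ?thesis by (intro bexI[of _ "Max D"]) (auto simp: I_def D_def)
  qed
  have nondeg: "\<exists>s t. s < t \<and> s \<in> I c \<and> t \<in> I c" for c
  proof -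
    define D where "D = {c' \<in> C. c < c'}"
    have D: "finite D" using C by (simp add: D_def)
    define t where "t = (if D = {} then c + 1 else (c + Min D) / 2)"
    have "c < t \<and> (\<forall>c'\<in>D. t < c')"
    proof (cases "D = {}")
      case False
      then have "c < Min D" using D Min_in[OF D False] by (simp add: D_def)
      moreover have "Min D \<le> c'" if "c' \<in> D" for c' using D that by simp
      ultimately show ?thesis using False by (force simp: t_def)
    qed (simp add: t_def)
    then show ?thesis by (intro exI[of _ c] exI[of _ t]) (auto simp: I_def D_def)
  qed
  have lin: "\<exists>L. linear L \<and> (\<forall>w\<in>P c. first_return a b (sector v v') w = L w)" for c
  proof (cases "P c = {}")
    case True
    then show ?thesis using linear_id by auto
  next
    case False
    then obtain w where w: "w \<in> sector v v'" "ccw_angle v w \<in> I c" by (auto simp: P_def)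
    show ?thesis
    proof (cases "c < 0")
      case True
      then have "ccw_angle v w < 0" using w(2) C(3) by (auto simp: I_def)
      then show ?thesis using ccw0[of w] by simp
    next
      case False
      \<comment> \<open>The initial ray of the piece, so that the piece has the form required by
        \<open>first_return_linear\<close>.\<close>
      define w0 where "w0 = circ (ang v + c)"
      have "c < 1" using w by (auto simp: I_def ccw_angle_ang frac_def) linarith
      have "ang w0 - (ang v + c) \<in> \<int>" unfolding w0_def by (rule ang_eqI[of 1]) auto
      then have "ccw_angle v w0 = frac c"
        unfolding ccw_angle_ang by (intro frac_eqI) (simp add: algebra_simps)
      then have c: "ccw_angle v w0 = c" using \<open>c < 1\<close> False by (simp add: frac_eq)
      have "c < ccw_angle v v'" using w by (auto simp: I_def sector_def)
      then have w0: "w0 \<in> sector v v'" using c by (simp add: sector_def w0_def)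
      show ?thesis
      proof (rule first_return_linear[OF vv' refl refl _ w0, where C = C])
        show "P c = {w \<in> sector v v'. ccw_angle v w0 \<le> ccw_angle v w \<and>
                 (\<forall>c\<in>C. ccw_angle v w0 < c \<longrightarrow> ccw_angle v w < c)}"
          by (auto simp: P_def I_def c)
      qed (rule cuts)
    qed
  qed
  show ?thesis
    unfolding pw_linear_sector_def
  proof (intro exI[of _ "P ` C"] conjI ballI)
    show "finite (P ` C)" using C by simp
    show "card (P ` C) \<le> k" using card_image_le[OF C(1), of P] C(2) by simp
    show "\<Union> (P ` C) = sector v v'" using cover ccw0 by (auto simp: P_def)
    show "disjoint (P ` C)"
      using I_disj by (auto simp: pairwise_def disjnt_def P_def)
    fix X assume "X \<in> P ` C"
    then obtain c where c: "X = P c" by auto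
    have "is_interval (I c)" by (auto simp: is_interval_1 I_def)
    then show "\<exists>I. is_interval I \<and> (\<exists>s t. s < t \<and> s \<in> I \<and> t \<in> I) \<and> X = {w \<in> sector v v'. ccw_angle v w \<in> I}"
      using nondeg[of c] by (intro exI[of _ "I c"]) (auto simp: c P_def)
    show "\<exists>L. linear L \<and> (\<forall>w\<in>X. first_return a b (sector v v') w = L w)"
      using lin[of c] by (simp add: c)
  qed
qed

end

section \<open>Special sectors\<close>

lemma Arg2pi_quotient:
  assumes "v \<noteq> 0" "w \<noteq> 0"
  shows "Arg2pi (Complex (fst w) (snd w) / Complex (fst v) (snd v)) = 2 * pi * ccw_angle v w"
proof (rule Arg2pi_unique)
  define z where "z p = Complex (fst p) (snd p)" for p :: "real \<times> real"
  have polar: "z p = of_real (norm p) * exp (\<i> * of_real (2 * pi * ang p))" for p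
  proof -
    have "norm p = cmod (z p)" by (cases p) (simp add: z_def norm_Pair cmod_def)
    moreover have "2 * pi * ang p = Arg (z p)" by (simp add: ang_def z_def)
    ultimately show ?thesis
      using rcis_cmod_Arg[of "z p"] by (simp add: rcis_def cis_conv_exp)
  qed
  have "2 * pi * ang w - 2 * pi * ang v = 2 * pi * ccw_angle v w + 2 * pi * of_int \<lfloor>ang w - ang v\<rfloor>"
    by (simp add: ccw_angle_ang frac_def algebra_simps)
  then have "exp (\<i> * of_real (2 * pi * ang w - 2 * pi * ang v)) = exp (\<i> * of_real (2 * pi * ccw_angle v w))"
    by (simp only: cis_conv_exp[symmetric] cis_mult[symmetric])
      (simp add: cis_mult[symmetric] cis_multiple_2pi)
  then show "of_real (norm w / norm v) * exp (\<i> * of_real (2 * pi * ccw_angle v w)) =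
      Complex (fst w) (snd w) / Complex (fst v) (snd v)"
    unfolding z_def[symmetric] polar[of w] polar[of v] by (simp add: exp_diff right_diff_distrib flip: times_divide_times_eq)
  show "2 * pi * ccw_angle v w < 2 * pi" by (simp add: ccw_angle_ang frac_lt_1)
qed (use assms in \<open>auto simp: ccw_angle_ang\<close>)

text \<open>The angle from \<open>v\<close> is the argument of a complex quotient, and
  \<open>Arg2pi\<close> is continuous off the nonnegative reals, that is, off the ray through
  \<open>v\<close>. The strict bounds on the angle thus persist nearby.\<close>

lemma interior_sectorI:
  assumes "v \<noteq> 0" "w \<in> sector v v'" "ccw_angle v w \<noteq> 0"
  shows "w \<in> interior (sector v v')"
proof -
  define z where "z p = Complex (fst p) (snd p) / Complex (fst v) (snd v)" for p
  have w: "w \<noteq> 0" "ccw_angle v w < ccw_angle v v'" using assms by (auto simp: sector_def)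
  have pos: "0 < ccw_angle v w" using assms(3) by (simp add: ccw_angle_ang less_le)
  have Arg: "Arg2pi (z p) = 2 * pi * ccw_angle v p" if "p \<noteq> 0" for p
    using Arg2pi_quotient[OF assms(1) that] by (simp add: z_def)
  have "Arg2pi (z w) \<noteq> 0" using Arg[OF w(1)] pos by simp
  then have "z w \<notin> \<real>\<^sub>\<ge>\<^sub>0" by (auto simp: Arg2pi_eq_0 complex_nonneg_Reals_iff complex_is_Real_iff)
  then have "isCont Arg2pi (z w)" by (rule continuous_at_Arg2pi)
  moreover have "isCont z w"
  proof -
    have "Complex (fst p) (snd p) = of_real (fst p) + \<i> * of_real (snd p)" for p :: "real \<times> real"
      by (simp add: complex_eq_iff)
    moreover have "Complex (fst v) (snd v) \<noteq> 0"
      using assms(1) by (auto simp: prod_eq_iff complex_eq_iff)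
    ultimately show ?thesis unfolding z_def by (simp only:) (intro continuous_intros; simp)
  qed
  ultimately have "isCont (\<lambda>p. Arg2pi (z p)) w" by (rule isCont_o2[rotated])
  then have "((\<lambda>p. Arg2pi (z p)) \<longlongrightarrow> 2 * pi * ccw_angle v w) (nhds w)"
    unfolding Arg[OF w(1), symmetric]
    by (simp only: isCont_def tendsto_at_iff_tendsto_nhds[of "\<lambda>p. Arg2pi (z p)" w])
  then have "eventually (\<lambda>p. Arg2pi (z p) \<in> {0<..<2 * pi * ccw_angle v v'}) (nhds w)"
    using pos w by (intro topological_tendstoD) auto
  moreover have "eventually (\<lambda>p. p \<noteq> 0) (nhds w)"
    using w(1) by (rule t1_space_nhds)
  ultimately have "eventually (\<lambda>p. p \<in> sector v v') (nhds w)"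
    by eventually_elim (auto simp: sector_def Arg)
  then show ?thesis by (auto simp: eventually_nhds interior_def)
qed

section \<open>Integer iterates and first backward hits\<close>

lemma Tab_iter_neg: "Tab_iter a b (- int n) p = (Tinv a b ^^ n) p"
  by (cases n) (auto simp: Tab_iter_def inv_Tab nat_add_distrib)

lemma Tab_iter_nat: "Tab_iter a b (int n) p = (Tab a b ^^ n) p"
  by (simp add: Tab_iter_def)

lemma Tinv_Tab_iter: "Tinv a b (Tab_iter a b j p) = Tab_iter a b (j - 1) p"
proof (cases "j > 0")
  case True
  then obtain n where "j = int (Suc n)" by (metis gr0_implies_Suc pos_int_cases)
  then show ?thesis using Tab_iter_nat[of a b "Suc n" p] Tab_iter_nat[of a b n p] by simp
next
  case False
  then obtain n where "j = - int n" by (metis int_cases2 neg_0_le_iff_le not_less nonpos_int_cases)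
  then have "j - 1 = - int (Suc n)" by simp
  then show ?thesis unfolding \<open>j = - int n\<close> by (simp only: Tab_iter_neg funpow.simps o_apply)
qed

lemma Tinv_funpow_Tab_iter: "(Tinv a b ^^ n) (Tab_iter a b j p) = Tab_iter a b (j - int n) p"
  by (induction n) (auto simp: Tinv_Tab_iter algebra_simps)

lemma Tab_iter_eq_0_iff: "Tab_iter a b j p = 0 \<longleftrightarrow> p = 0"
  by (simp add: Tab_iter_def inv_Tab)

text \<open>Reduces the cuts coming from the orbit of one break ray to at most one besides
  \<open>v\<close>: with \<open>\<phi>\<close> the angle from \<open>v\<close>, every such cut is at angle 0 or at the first hit past the end
  of the given orbit segment.\<close>
lemma backward_hit:
  fixes J p a b and m n :: nat
  defines "k \<equiv> LEAST k. Tab_iter a b (- int (m + k)) p \<in> J"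
  assumes seg: "\<And>j. \<lbrakk>- int m < j; j \<le> int n; Tab_iter a b j p \<in> J\<rbrakk> \<Longrightarrow> \<phi> (Tab_iter a b j p) = 0"
    and j: "j = 1 \<or> (- int m < j \<and> j \<le> int n)"
    and i: "i \<ge> 1" "Tab_iter a b (j - int i) p \<in> J"
      "\<And>l. 0 < l \<Longrightarrow> l < i \<Longrightarrow> Tab_iter a b (j - int l) p \<notin> J"
  shows "\<phi> (Tab_iter a b (j - int i) p) \<in> {0, \<phi> (Tab_iter a b (- int (m + k)) p)}"
proof (cases "- int m < j - int i")
  case True
  then show ?thesis using seg[of "j - int i"] i j by auto
next
  case False
  define l where "l = nat (- (j - int i) - int m)"
  have l: "j - int i = - int (m + l)" using False by (simp add: l_def)
  have "k = l"
    unfolding k_def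
  proof (rule Least_equality)
    \<comment> \<open>A hit past the end of the segment but before \<open>l\<close> would lie fewer
      than \<open>i\<close> steps behind \<open>j\<close>, against the choice of
      \<open>i\<close>.\<close>
    show "Tab_iter a b (- int (m + l)) p \<in> J" using i(2) l by simp
    fix y assume y: "Tab_iter a b (- int (m + y)) p \<in> J"
    show "l \<le> y"
    proof (rule ccontr)
      assume "\<not> l \<le> y"
      define x where "x = nat (j + int (m + y))"
      have x: "- int (m + y) = j - int x" "0 < x" "x < i"
        using j l \<open>\<not> l \<le> y\<close> by (auto simp: x_def)
      then show False using i(3)[of x] y by simp
    qed
  qed
  then show ?thesis using l by simp
qed

lemma ccw_angle_pos:
  assumes "v \<noteq> 0" "v' \<noteq> 0" "\<not> same_ray v v'"
  shows "0 < ccw_angle v v'"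
  using assms by (simp add: same_ray_iff_ang ccw_angle_ang frac_gt_0_iff)

section \<open>The bounds five and three\<close>

context lifted_map
begin

lemma pw_linear_five:
  assumes "v \<noteq> 0" "v' \<noteq> 0" "\<not> same_ray v v'"
  shows "pw_linear_sector v v' (first_return a b (sector v v')) 5"
proof -
  \<comment> \<open>The \<open>LEAST\<close> is evaluated only for marks that do hit the sector; for
    any other mark the value would merely add a cut.\<close>
  define c where "c m = ccw_angle v ((Ti ^^ (LEAST n. n \<ge> 1 \<and> (Ti ^^ n) m \<in> sector v v')) m)" for m
  show ?thesis
  proof (rule pw_linear_of_cuts[where C = "{0, c v, c v', c (T (0, 1)), c (T (0, -1))}"])
    have "card {0, c v, c v', c (T (0, 1)), c (T (0, -1))} \<le> card (set [0, c v, c v', c (T (0, 1)), c (T (0, -1))])"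
      by simp
    also have "\<dots> \<le> 5" by (rule order_trans[OF card_length]) simp
    finally show "card {0, c v, c v', c (T (0, 1)), c (T (0, -1))} \<le> 5" .
    fix m n assume m: "m \<in> {v, v', T (0, 1), T (0, -1)}" and n: "n \<ge> 1" "(Ti ^^ n) m \<in> sector v v'"
      "\<And>i. 0 < i \<Longrightarrow> i < n \<Longrightarrow> (Ti ^^ i) m \<notin> sector v v'"
    have "(LEAST n. n \<ge> 1 \<and> (Ti ^^ n) m \<in> sector v v') = n"
    proof (rule Least_equality)
      fix y assume "1 \<le> y \<and> (Ti ^^ y) m \<in> sector v v'"
      then show "n \<le> y" using n(3)[of y] by (cases "n \<le> y") auto
    qed (use n in simp)
    then have "ccw_angle v ((Ti ^^ n) m) = c m" by (simp add: c_def)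
    then show "ccw_angle v ((Ti ^^ n) m) \<in> {0, c v, c v', c (T (0, 1)), c (T (0, -1))}"
      using m by auto
  qed (use assms in \<open>auto intro: ccw_angle_pos\<close>)
qed

text \<open>The boundary rays now lie on the orbits of the two breaks, so every mark is an iterate
  of a break, and \<open>backward_hit\<close> leaves one cut per break besides the cut at 0.\<close>

lemma pw_linear_three:
  fixes mp mm np nm :: nat
  defines "Orb \<equiv> {Tab_iter a b j (0, 1) | j. - int mm < j \<and> j \<le> int mp}
              \<union> {Tab_iter a b j (0, -1) | j. - int nm < j \<and> j \<le> int np}"
  assumes vO: "v \<in> Orb" "v' \<in> Orb" and nray: "\<not> same_ray v v'"
    and int: "Orb \<inter> interior (sector v v') = {}"
  shows "pw_linear_sector v v' (first_return a b (sector v v')) 3"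
proof -
  let ?J = "sector v v'"
  define c where "c m p = ccw_angle v (Tab_iter a b (- int (m + (LEAST k. Tab_iter a b (- int (m + k)) p \<in> ?J))) p)"
    for m and p :: "real \<times> real"
  have nz: "w \<noteq> 0" if "w \<in> Orb" for w
    using that break_nonzero by (auto simp: Orb_def Tab_iter_eq_0_iff)
  \<comment> \<open>A point of \<open>Orb\<close> in the sector is not interior, which leaves only
    the ray through \<open>v\<close>.\<close>
  have ccw0: "ccw_angle v w = 0" if "w \<in> Orb" "w \<in> ?J" for w
    using interior_sectorI[of v w v'] that int nz[OF vO(1)] by auto
  have T1: "T q = Tab_iter a b 1 q" for q by (simp add: Tab_iter_def)
  show ?thesis
  proof (rule pw_linear_of_cuts[where C = "{0, c mm (0, 1), c nm (0, -1)}"])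
    have "card {0, c mm (0, 1), c nm (0, -1)} = card (set [0, c mm (0, 1), c nm (0, -1)])"
      by simp
    also have "\<dots> \<le> 3" by (rule order_trans[OF card_length]) simp
    finally show "card {0, c mm (0, 1), c nm (0, -1)} \<le> 3" .
    fix m n assume m: "m \<in> {v, v', T (0, 1), T (0, -1)}" and n: "n \<ge> 1" "(Ti ^^ n) m \<in> sector v v'"
      "\<And>i. 0 < i \<Longrightarrow> i < n \<Longrightarrow> (Ti ^^ i) m \<notin> sector v v'"
    have "m \<in> Orb \<or> m = Tab_iter a b 1 (0, 1) \<or> m = Tab_iter a b 1 (0, -1)"
      using m vO T1 by auto
    then consider
        j where "j = 1 \<or> (- int mm < j \<and> j \<le> int mp)" "m = Tab_iter a b j (0, 1)"
      | j where "j = 1 \<or> (- int nm < j \<and> j \<le> int np)" "m = Tab_iter a b j (0, -1)"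
      unfolding Orb_def by blast
    then show "ccw_angle v ((Ti ^^ n) m) \<in> {0, c mm (0, 1), c nm (0, -1)}"
    proof cases
      case 1
      have "ccw_angle v (Tab_iter a b (j - int n) (0, 1)) \<in> {0, c mm (0, 1)}"
        unfolding c_def
        using 1 n by (intro backward_hit[where n = mp and \<phi> = "ccw_angle v"] ccw0)
          (auto simp: Orb_def Tinv_funpow_Tab_iter)
      then show ?thesis using 1 by (auto simp: Tinv_funpow_Tab_iter)
    next
      case 2
      have "ccw_angle v (Tab_iter a b (j - int n) (0, -1)) \<in> {0, c nm (0, -1)}"
        unfolding c_def
        using 2 n by (intro backward_hit[where n = np and \<phi> = "ccw_angle v"] ccw0)
          (auto simp: Orb_def Tinv_funpow_Tab_iter)
      then show ?thesis using 2 by (auto simp: Tinv_funpow_Tab_iter)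
    qed
  next
    show "0 < ccw_angle v v'" using vO nray by (intro ccw_angle_pos nz)
  qed (simp_all add: nz vO)
qed

end

text \<open>The positive and the nonpositive times are adjacent, so the two families form one
  segment with consecutive integer indices, the form used by \<open>backward_hit\<close>.\<close>

lemma orbit_segment_eq:
  "{Tab_iter a b (1 + int i) p | i. i < mp} \<union> {Tab_iter a b (- int i) p | i. i < mm}
    = {Tab_iter a b j p | j. - int mm < j \<and> j \<le> int mp}"
proof (intro equalityI subsetI)
  fix x assume "x \<in> {Tab_iter a b j p | j. - int mm < j \<and> j \<le> int mp}"
  then obtain j where j: "x = Tab_iter a b j p" "- int mm < j" "j \<le> int mp" by auto
  show "x \<in> {Tab_iter a b (1 + int i) p | i. i < mp} \<union> {Tab_iter a b (- int i) p | i. i < mm}"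
  proof (cases "j \<ge> 1")
    case True
    then have "j = 1 + int (nat (j - 1))" "nat (j - 1) < mp" using j by auto
    then show ?thesis unfolding j(1) by (intro UnI1 CollectI exI[of _ "nat (j - 1)"]) simp
  next
    case False
    then have "j = - int (nat (- j))" "nat (- j) < mm" using j by auto
    then show ?thesis unfolding j(1) by (intro UnI2 CollectI exI[of _ "nat (- j)"]) simp
  qed
qed force

theorem theorem3p1:
  fixes a b :: real
  assumes irr: "\<exists>\<rho>. has_rotation_number a b \<rho> \<and> \<rho> \<notin> \<rat>"
  shows "(\<forall>v v'. v \<noteq> 0 \<and> v' \<noteq> 0 \<and> \<not> same_ray v v' \<longrightarrow>
            pw_linear_sector v v' (first_return a b (sector v v')) 5)
       \<and> (\<forall>(mp::nat) (mm::nat) (np::nat) (nm::nat) v v'.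
            (let O1 = {Tab_iter a b (1 + int i) (0, 1) | i. i < mp};
                 O2 = {Tab_iter a b (- int i) (0, 1) | i. i < mm};
                 O3 = {Tab_iter a b (1 + int i) (0, -1) | i. i < np};
                 O4 = {Tab_iter a b (- int i) (0, -1) | i. i < nm};
                 Orb = O1 \<union> O2 \<union> O3 \<union> O4
             in v \<in> Orb \<and> v' \<in> Orb \<and> \<not> same_ray v v' \<and> Orb \<inter> interior (sector v v') = {}
                \<longrightarrow> pw_linear_sector v v' (first_return a b (sector v v')) 3))"
proof -
  from irr obtain \<rho> F where F: "\<rho> \<notin> \<rat>" "continuous_on UNIV F"
    "\<forall>\<theta>. Sab a b (circ \<theta>) = circ (F \<theta>)" "(\<lambda>n. (F ^^ n) 0 / real n) \<longlonglongrightarrow> \<rho>"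
    unfolding has_rotation_number_def by blast
  interpret lifted_map a b F \<rho>
    using F by unfold_locales auto
  have seg: "{Tab_iter a b (1 + int i) (0, 1) | i. i < mp} \<union> {Tab_iter a b (- int i) (0, 1) | i. i < mm}
      \<union> {Tab_iter a b (1 + int i) (0, -1) | i. i < np} \<union> {Tab_iter a b (- int i) (0, -1) | i. i < nm}
    = {Tab_iter a b j (0, 1) | j. - int mm < j \<and> j \<le> int mp}
      \<union> {Tab_iter a b j (0, -1) | j. - int nm < j \<and> j \<le> int np}" for mp mm np nm
    unfolding orbit_segment_eq[symmetric] by (simp only: Un_assoc)
  show ?thesis
    unfolding Let_def seg
    by (intro conjI allI impI; elim conjE; rule pw_linear_five pw_linear_three; assumption)
qed

end
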